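(* Let $1\le\ell_1\le\dots\le\ell_r\le n$ and $T=C_r\otimes\cdots\otimes C_1\in B(\varpi_{\ell_r})\otimes\cdots\otimes B(\varpi_{\ell_1})$. (a) If $T$ is not semistandard then $\Psi_T=0$. (b) If $T$ is highest weight, of shape $\lambda=\sum_{i=1}^r\varpi_{\ell_i}$, then $\Psi_T=\mathbf 1_\lambda$. (c) Let $\mu\in(\mathbb Z^n_{\ge0})_+$ with $\ell(\mu)\le\ell_1$ and suppose $T\otimes T^0_\mu$ is semistandard. Let $j\in[n-1]$ with $j\notin C_1$ and $j+1\in C_1$. Then, writing $\Sigma=\sum_{1\le k<r,\ \sigma^j_{C_k}\sigma^j_{C_{k+1}}=-1}\sigma^j_{C_k}(1-t)\Psi_{\Omega^j_k(T)\otimes T^0_\mu}$, $$\Psi_{T\otimes T^0_\mu}=\begin{cases}T_j\,\Psi_{\Omega^j_r(T)\otimes T^0_\mu}+\Sigma, & \text{if } j\in C_r,\ j+1\notin C_r,\\ tT_j^{-1}\,\Psi_{\Omega^j_r(T)\otimes T^0_\mu}+\Sigma, & \text{otherwise.}\end{cases}$$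
   Context: Fix $n\ge1$, $[n]=\{1,\dots,n\}$. $S_n$ is the symmetric group with simple transpositions $s_i=(i,i+1)$ and length function $\ell(\cdot)$. $S_n$ acts on $\mathbb Z^n$ by permuting coordinates; $\varepsilon_1,\dots,\varepsilon_n$ is the standard basis, $\varpi_k=\varepsilon_1+\dots+\varepsilon_k$. $(\mathbb Z^n_{\ge0})_+=\{\lambda\in\mathbb Z^n_{\ge0}:\lambda_1\ge\dots\ge\lambda_n\}$; $\ell(\mu)$ is the number of nonzero parts of $\mu$. For $\lambda\in\mathbb Z^n$, $S_{n,\lambda}=\{w:w\lambda=\lambda\}$. The affine Hecke algebra $H$ is the $\mathbb Z[t^{\pm1}]$-algebra with generators $T_1,\dots,T_{n-1},X_1^{\pm1},\dots,X_n^{\pm1}$ and relations $T_i^2=(t-1)T_i+t$, $T_iT_{i+1}T_i=T_{i+1}T_iT_{i+1}$, $T_iT_j=T_jT_i$ for $|i-j|>1$, $X_iX_j=X_jX_i$, $T_iX_iT_i=tX_{i+1}$, $T_iX_j=X_jT_i$ for $j\notin\{i,i+1\}$ ($tT_i^{-1}=T_i+1-t$). $T_w=T_{i_1}\cdots T_{i_m}$ for a reduced expression $w=s_{i_1}\cdots s_{i_m}$. $H_n$ is the subalgebra generated by the $T_i$ (basis $\{T_w\}_{w\in S_n}$); $H_{n,\lambda}$ is the span of $\{T_w:w\in S_{n,\lambda}\}$, and $\mathbf 1_\lambda=\sum_{w\in S_{n,\lambda}}T_w$. Columns: a column of length $\ell$ is $C=(c_1<\dots<c_\ell)\subseteq[n]$;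 $B(\varpi_\ell)$ is their set. $u_C\in S_n$ sends $k\mapsto c_k$ ($k\le\ell$) and sends $\ell+1,\dots,n$ increasingly onto $[n]\setminus C$. $s_jC$ is the column whose underlying set is the image of $C$ under the transposition $(j,j+1)$. $\sigma^j_C=-1$ if $j\in C$, $j+1\notin C$, and $\sigma^j_C=+1$ otherwise. The column $(1,\dots,\ell)$ is highest weight. Tableaux: for $1\le\ell_1\le\dots\le\ell_r\le n$, $B(\varpi_{\ell_r})\otimes\cdots\otimes B(\varpi_{\ell_1})$ is the set of $T=C_r\otimes\cdots\otimes C_1$, $C_i\in B(\varpi_{\ell_i})$, viewed as a filling of the Young diagram of $\sum\varpi_{\ell_i}$ with columns $C_r,\dots,C_1$ from left to right; $T$ is semistandard if rows weakly increase left to right, and highest weight if all its columns are highest weight. Concatenation $T\otimes T'$ is defined when every column of $T$ is at least as long as every column of $T'$. For $\mu\in(\mathbb Z^n_{\ge0})_+$, $T^0_\mu$ is the tableau of shape $\mu$ all of whose columns are highest weight (row $i$ filled with $i$); $T^0_0$ is empty. For $k\in[r]$, $\Omega^j_k(T)=C_r\otimes\cdots\otimes C_{k+1}\otimes s_jC_k\otimes\cdots\otimes s_jC_1$. Definition of $\Psi$: every $h\in H_n$ is uniquely $h=\sum_{F\in B(\varpi_\ell)}T_{u_F}h_F$ with $h_F\in H_{n,\varpi_\ell}$. For a column $C\in B(\varpi_\ell)$, $\Psi_C=t^{\ell(u_C)}(T_{u_C^{-1}})^{-1}\mathbf 1_{\varpi_\ell}$; for $T=C\otimes S$ with $C\in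 B(\varpi_\ell)$, $S$ a tensor of columns of lengths $\le\ell$, write $\Psi_S=\sum_{E\in B(\varpi_\ell)}T_{u_E}h_{E,S}$ with $h_{E,S}\in H_{n,\varpi_\ell}$, and set $\Psi_T=t^{\ell(u_C)}(T_{u_C^{-1}})^{-1}h_{C,S}$. *)

theory Defs
  imports "HOL-Combinatorics.Combinatorics"
begin

definition perms :: "nat \<Rightarrow> (nat \<Rightarrow> nat) set" where
  "perms n = {w. w permutes {1..n}}"

definition len :: "nat \<Rightarrow> (nat \<Rightarrow> nat) \<Rightarrow> nat" where
  "len n w = card {(i, j). i \<in> {1..n} \<and> j \<in> {1..n} \<and> i < j \<and> w j < w i}"

definition sgen :: "nat \<Rightarrow> nat \<Rightarrow> nat" where
  "sgen i = Transposition.transpose i (Suc i)"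

text \<open>Elements of the finite Hecke algebra H_n over a commutative ring with a unit t:
  coefficient functions on S_n (the coefficient of T_w), zero outside S_n.\<close>

type_synonym 'a hecke = "(nat \<Rightarrow> nat) \<Rightarrow> 'a"

definition hecke :: "nat \<Rightarrow> 'a::comm_ring_1 hecke set" where
  "hecke n = {h. \<forall>w. w \<notin> perms n \<longrightarrow> h w = 0}"

definition hzero :: "'a::comm_ring_1 hecke" where
  "hzero = (\<lambda>_. 0)"

definition hbasis :: "(nat \<Rightarrow> nat) \<Rightarrow> 'a::comm_ring_1 hecke" where
  "hbasis w = (\<lambda>v. if v = w then 1 else 0)"

definition hone :: "'a::comm_ring_1 hecke" where
  "hone = hbasis id"

definition hadd :: "'a::comm_ring_1 hecke \<Rightarrow> 'a hecke \<Rightarrow> 'a hecke" where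
  "hadd h g = (\<lambda>w. h w + g w)"

definition hscale :: "'a::comm_ring_1 \<Rightarrow> 'a hecke \<Rightarrow> 'a hecke" where
  "hscale c h = (\<lambda>w. c * h w)"

definition hsum :: "('b \<Rightarrow> 'a::comm_ring_1 hecke) \<Rightarrow> 'b set \<Rightarrow> 'a hecke" where
  "hsum f A = (\<lambda>v. \<Sum>x\<in>A. f x v)"

text \<open>Left multiplication by the generator T_i:
  T_i T_w = T_{s_i w} if l(s_i w) > l(w), and (t-1) T_w + t T_{s_i w} otherwise.\<close>

definition hgen_mult :: "'a::comm_ring_1 \<Rightarrow> nat \<Rightarrow> nat \<Rightarrow> 'a hecke \<Rightarrow> 'a hecke" where
  "hgen_mult t n i h = (\<lambda>v. if v \<in> perms n then
      (if len n (sgen i \<circ> v) < len n v then h (sgen i \<circ> v) + (t - 1) * h v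
       else t * h (sgen i \<circ> v))
    else 0)"

definition reduced_word :: "nat \<Rightarrow> (nat \<Rightarrow> nat) \<Rightarrow> nat list \<Rightarrow> bool" where
  "reduced_word n w is \<longleftrightarrow> set is \<subseteq> {1..<n} \<and> w = foldr (\<lambda>i acc. sgen i \<circ> acc) is id
     \<and> length is = len n w"

definition hbasis_mult :: "'a::comm_ring_1 \<Rightarrow> nat \<Rightarrow> (nat \<Rightarrow> nat) \<Rightarrow> 'a hecke \<Rightarrow> 'a hecke" where
  "hbasis_mult t n w g = foldr (hgen_mult t n) (SOME is. reduced_word n w is) g"

definition hmult :: "'a::comm_ring_1 \<Rightarrow> nat \<Rightarrow> 'a hecke \<Rightarrow> 'a hecke \<Rightarrow> 'a hecke" where
  "hmult t n h g = (\<lambda>v. \<Sum>w\<in>perms n. h w * hbasis_mult t n w g v)"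

definition hinv :: "'a::comm_ring_1 \<Rightarrow> nat \<Rightarrow> 'a hecke \<Rightarrow> 'a hecke" where
  "hinv t n h = (THE g. g \<in> hecke n \<and> hmult t n h g = hone \<and> hmult t n g h = hone)"

definition stab :: "nat \<Rightarrow> (nat \<Rightarrow> int) \<Rightarrow> (nat \<Rightarrow> nat) set" where
  "stab n lam = {w \<in> perms n. \<forall>i\<in>{1..n}. lam (w i) = lam i}"

definition hpar :: "nat \<Rightarrow> (nat \<Rightarrow> int) \<Rightarrow> 'a::comm_ring_1 hecke set" where
  "hpar n lam = {h \<in> hecke n. \<forall>w. w \<notin> stab n lam \<longrightarrow> h w = 0}"

definition one_lam :: "nat \<Rightarrow> (nat \<Rightarrow> int) \<Rightarrow> 'a::comm_ring_1 hecke" where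
  "one_lam n lam = (\<lambda>w. if w \<in> stab n lam then 1 else 0)"

definition varpi :: "nat \<Rightarrow> nat \<Rightarrow> int" where
  "varpi l = (\<lambda>i. if i \<le> l then 1 else 0)"

definition cols :: "nat \<Rightarrow> nat \<Rightarrow> nat set set" where
  "cols n l = {C. C \<subseteq> {1..n} \<and> card C = l}"

definition entry :: "nat set \<Rightarrow> nat \<Rightarrow> nat" where
  "entry C k = sorted_list_of_set C ! (k - 1)"

definition uC :: "nat \<Rightarrow> nat set \<Rightarrow> nat \<Rightarrow> nat" where
  "uC n C = (\<lambda>k. if k \<in> {1..card C} then entry C k
     else if k \<in> {Suc (card C)..n} then sorted_list_of_set ({1..n} - C) ! (k - Suc (card C))
     else k)"

definition component :: "'a::comm_ring_1 \<Rightarrow> nat \<Rightarrow> nat \<Rightarrow> 'a hecke \<Rightarrow> nat set \<Rightarrow> 'a hecke" where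
  "component t n l h = (THE f. (\<forall>F\<in>cols n l. f F \<in> hpar n (varpi l))
      \<and> (\<forall>F. F \<notin> cols n l \<longrightarrow> f F = hzero)
      \<and> h = hsum (\<lambda>F. hmult t n (hbasis (uC n F)) (f F)) (cols n l))"

text \<open>Tensors of columns C_r (x) ... (x) C_1 as lists [C_r, ..., C_1] (left to right).\<close>

fun Psi :: "'a::comm_ring_1 \<Rightarrow> nat \<Rightarrow> nat set list \<Rightarrow> 'a hecke" where
  "Psi t n [] = hone"
| "Psi t n [C] = hscale (t ^ len n (uC n C))
     (hmult t n (hinv t n (hbasis (inv (uC n C)))) (one_lam n (varpi (card C))))"
| "Psi t n (C # D # S) = hscale (t ^ len n (uC n C))
     (hmult t n (hinv t n (hbasis (inv (uC n C)))) (component t n (card C) (Psi t n (D # S)) C))"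

definition is_tab :: "nat \<Rightarrow> nat set list \<Rightarrow> bool" where
  "is_tab n T \<longleftrightarrow> T \<noteq> [] \<and> (\<forall>C\<in>set T. C \<subseteq> {1..n} \<and> 1 \<le> card C)
     \<and> sorted_wrt (\<lambda>C D. card D \<le> card C) T"

definition semistandard :: "nat set list \<Rightarrow> bool" where
  "semistandard T \<longleftrightarrow> (\<forall>i. Suc i < length T \<longrightarrow>
      (\<forall>k\<in>{1..card (T ! Suc i)}. entry (T ! i) k \<le> entry (T ! Suc i) k))"

definition highest_weight :: "nat set list \<Rightarrow> bool" where
  "highest_weight T \<longleftrightarrow> (\<forall>C\<in>set T. C = {1..card C})"

text \<open>Shape sum_i varpi_{l_i}: its i-th part is the number of columns of length >= i.\<close>

definition shape :: "nat set list \<Rightarrow> nat \<Rightarrow> int" where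
  "shape T = (\<lambda>i. int (length (filter (\<lambda>C. i \<le> card C) T)))"

definition sigma :: "nat \<Rightarrow> nat set \<Rightarrow> int" where
  "sigma j C = (if j \<in> C \<and> Suc j \<notin> C then -1 else 1)"

definition scol :: "nat \<Rightarrow> nat set \<Rightarrow> nat set" where
  "scol j C = Transposition.transpose j (Suc j) ` C"

definition colk :: "nat set list \<Rightarrow> nat \<Rightarrow> nat set" where
  "colk T k = T ! (length T - k)"

definition Omega :: "nat \<Rightarrow> nat \<Rightarrow> nat set list \<Rightarrow> nat set list" where
  "Omega j k T = take (length T - k) T @ map (scol j) (drop (length T - k) T)"

definition is_partition :: "nat \<Rightarrow> (nat \<Rightarrow> nat) \<Rightarrow> bool" where
  "is_partition n mu \<longleftrightarrow> (\<forall>i\<in>{1..n}. \<forall>j\<in>{1..n}. i \<le> j \<longrightarrow> mu j \<le> mu i)"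

definition nparts :: "nat \<Rightarrow> (nat \<Rightarrow> nat) \<Rightarrow> nat" where
  "nparts n mu = card {i \<in> {1..n}. mu i \<noteq> 0}"

definition T0 :: "nat \<Rightarrow> (nat \<Rightarrow> nat) \<Rightarrow> nat set list" where
  "T0 n mu = map (\<lambda>c. {1..card {i \<in> {1..n}. c \<le> mu i}}) [1..<Suc (mu 1)]"

end

theory Submission
  imports Defs
begin

text \<open>
  The bar version of \<open>T\<^sub>j\<close> is \<open>t T\<^sub>j\<^sup>-\<^sup>1 = T\<^sub>j + 1 - t\<close>. \<open>\<Psi>\<close> is built by
  applying \<open>h \<mapsto> B\<^sub>C (h\<^sub>C)\<close>, where \<open>h\<^sub>C\<close> is the component of \<open>h\<close> at \<open>C\<close> and
  \<open>B\<^sub>C = t\<^bsup>l(u)\<^esup> T\<^bsub>inv u\<^esub>\<^sup>-\<^sup>1\<close> with \<open>u = u\<^sub>C\<close>. Both factors intertwine multiplication by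
  \<open>T\<^sub>j\<close> (if \<open>\<sigma> = -1\<close>) or its bar version (if \<open>\<sigma> = 1\<close>) with the reflection \<open>C \<mapsto> s\<^sub>jC\<close>,
  and a change of sign between neighbouring columns costs a multiple of \<open>1 - t\<close>: this gives
  (c) by induction on the number of columns, semistandardness entering only in the one-column
  case, where it says that \<open>s\<^sub>j\<close> stabilises \<open>\<mu>\<close>.
  For (a), \<open>B\<^sub>D h\<close> with \<open>h\<close> in the parabolic subalgebra is supported on permutations \<open>w\<close> for
  which \<open>w{1..m}\<close> is below \<open>D\<close> in the Gale order, so its component at \<open>C\<close> vanishes unless the
  rows of \<open>C \<otimes> D\<close> increase weakly.
\<close>

section \<open>Permutations and length\<close>

lemma permsD:
  assumes "w \<in> perms n"
  shows "w permutes {1..n}" "bij w" "inj w" "surj w" "inv w \<in> perms n"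
    "w (inv w x) = x" "inv w (w x) = x" "w \<circ> inv w = id" "inv w \<circ> w = id"
    "w x \<in> {1..n} \<longleftrightarrow> x \<in> {1..n}"
proof -
  show p: "w permutes {1..n}" using assms by (simp add: perms_def)
  show "bij w" "inj w" "surj w"
    using p by (auto simp: permutes_bij permutes_inj permutes_surj)
  show "inv w \<in> perms n" using p by (simp add: perms_def permutes_inv)
  show "w (inv w x) = x" "inv w (w x) = x" using p by (auto simp: permutes_inverses)
  show "w \<circ> inv w = id" "inv w \<circ> w = id" using p by (auto simp: permutes_inv_o)
  show "w x \<in> {1..n} \<longleftrightarrow> x \<in> {1..n}" using p by (rule permutes_in_image)
qed

lemma perms_comp [intro]: "v \<in> perms n \<Longrightarrow> w \<in> perms n \<Longrightarrow> v \<circ> w \<in> perms n"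
  by (simp add: perms_def permutes_compose)

lemma inv_comp_permsD:
  assumes "u \<in> perms n" "inv u \<circ> w \<in> perms n" shows "w \<in> perms n"
proof -
  have "u \<circ> (inv u \<circ> w) \<in> perms n" using assms by blast
  then show ?thesis using permsD(8)[OF assms(1)] by (simp add: o_assoc)
qed

lemma id_perms [simp]: "id \<in> perms n"
  by (simp add: perms_def permutes_id)

lemma finite_perms [simp]: "finite (perms n)"
  by (simp add: perms_def finite_permutations)

lemma inv_comp_perms: "v \<in> perms n \<Longrightarrow> w \<in> perms n \<Longrightarrow> inv (v \<circ> w) = inv w \<circ> inv v"
  by (simp add: o_inv_distrib permsD)

section \<open>Simple transpositions and their effect on length\<close>

lemma sgen_sgen [simp]: "sgen i (sgen i x) = x" "sgen i \<circ> sgen i = id"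
  "sgen i \<circ> (sgen i \<circ> w) = w" "w \<circ> sgen i \<circ> sgen i = w"
  by (auto simp: sgen_def fun_eq_iff)

lemma sgen_perms [simp]: "i \<in> {1..<n} \<Longrightarrow> sgen i \<in> perms n"
  by (simp add: sgen_def perms_def permutes_swap_id)

lemma inv_sgen [simp]: "inv (sgen i) = sgen i"
  by (simp add: sgen_def)

lemma sgen_apply: "sgen i x = (if x = i then Suc i else if x = Suc i then i else x)"
  by (simp add: sgen_def Transposition.transpose_def)

lemma sgen_comp_perms_iff [simp]: "i \<in> {1..<n} \<Longrightarrow> sgen i \<circ> w \<in> perms n \<longleftrightarrow> w \<in> perms n"
  by (metis perms_comp sgen_perms sgen_sgen(3))

lemma comp_sgen_perms_iff [simp]: "i \<in> {1..<n} \<Longrightarrow> w \<circ> sgen i \<in> perms n \<longleftrightarrow> w \<in> perms n"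
  by (metis perms_comp sgen_perms sgen_sgen(4))

lemma sgen_less: "x < y \<Longrightarrow> \<not> (x = j \<and> y = Suc j) \<Longrightarrow> sgen j x < sgen j y"
  by (auto simp: sgen_apply)

lemma sgen_less_iff: "x \<noteq> y \<Longrightarrow> {x, y} \<noteq> {j, Suc j} \<Longrightarrow> sgen j x < sgen j y \<longleftrightarrow> x < y"
  by (auto simp: sgen_apply)

text \<open>Conjugating a transposition by \<open>v\<close> transposes the images: v s_j v^{-1}
  exchanges \<open>v j\<close> and \<open>v (Suc j)\<close>.\<close>

lemma sgen_comp_eq_comp_sgen:
  assumes "inj v" "{v j, v (Suc j)} = {i, Suc i}"
  shows "sgen i \<circ> v = v \<circ> sgen j"
proof -
  have "sgen i \<circ> v = Transposition.transpose (v j) (v (Suc j)) \<circ> v"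
    using assms(2) by (auto simp: doubleton_eq_iff sgen_def transpose_commute)
  also have "\<dots> = v \<circ> sgen j"
  proof (rule ext)
    fix x
    consider "x = j" | "x = Suc j" | "x \<noteq> j" "x \<noteq> Suc j" by blast
    then show "(Transposition.transpose (v j) (v (Suc j)) \<circ> v) x = (v \<circ> sgen j) x"
      by cases (use inj_eq[OF assms(1), of x] in \<open>simp_all add: sgen_apply\<close>)
  qed
  finally show ?thesis .
qed

text \<open>Exchanging the values i and i+1 alters the comparison at one pair of positions only, the
  pair carrying these values, and that pair becomes a new inversion.\<close>

lemma len_sgen_comp_up:
  assumes w: "w \<in> perms n" and i: "i \<in> {1..<n}" and less: "inv w i < inv w (Suc i)"
  shows "len n (sgen i \<circ> w) = Suc (len n w)"
proof -
  let ?I = "\<lambda>w. {(a, b). a \<in> {1..n} \<and> b \<in> {1..n} \<and> a < b \<and> w b < w a}"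
  note W = permsD[OF w] permsD(10)[OF permsD(5)[OF w]]
  have fin: "finite (?I w)"
    by (rule finite_subset[of _ "{1..n} \<times> {1..n}"]) auto
  have key: "sgen i (w b) < sgen i (w a) \<longleftrightarrow> w b < w a \<or> (w a = i \<and> w b = Suc i)"
    if "a < b" for a b
  proof -
    have "w a \<noteq> w b" using that W(3) by (metis injD less_irrefl)
    moreover have "\<not> (w a = Suc i \<and> w b = i)"
      using less that W(7) by (metis less_asym)
    ultimately show ?thesis by (auto simp: sgen_apply)
  qed
  have "?I (sgen i \<circ> w) = insert (inv w i, inv w (Suc i)) (?I w)"
  proof (rule set_eqI, clarify)
    fix a b
    have "(w a = i \<and> w b = Suc i) \<longleftrightarrow> (a, b) = (inv w i, inv w (Suc i))"
      using W(6,7) by (metis prod.inject)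
    moreover have "inv w i \<in> {1..n}" "inv w (Suc i) \<in> {1..n}"
      using i W(11) by auto
    ultimately show "(a, b) \<in> ?I (sgen i \<circ> w)
        \<longleftrightarrow> (a, b) \<in> insert (inv w i, inv w (Suc i)) (?I w)"
      using key[of a b] less by (cases "a < b") auto
  qed
  moreover have "(inv w i, inv w (Suc i)) \<notin> ?I w" using W(6) by auto
  ultimately show ?thesis using fin by (simp add: len_def)
qed

lemma len_sgen_comp_down:
  assumes w: "w \<in> perms n" and i: "i \<in> {1..<n}" and less: "inv w (Suc i) < inv w i"
  shows "Suc (len n (sgen i \<circ> w)) = len n w"
proof -
  have "inv (sgen i \<circ> w) = inv w \<circ> sgen i"
    using w i by (simp add: inv_comp_perms[where n = n])
  then show ?thesis
    using len_sgen_comp_up[of "sgen i \<circ> w" n i] w i less by (simp add: sgen_apply)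
qed

lemma inv_neq: "w \<in> perms n \<Longrightarrow> inv w i \<noteq> inv w (Suc i)"
  by (metis n_not_Suc_n permsD(6))

lemma len_sgen_comp_less_iff:
  assumes "w \<in> perms n" "i \<in> {1..<n}"
  shows "len n (sgen i \<circ> w) < len n w \<longleftrightarrow> inv w (Suc i) < inv w i"
  using len_sgen_comp_up[OF assms] len_sgen_comp_down[OF assms] inv_neq[OF assms(1), of i]
  by (metis Suc_lessD lessI less_irrefl linorder_neqE_nat)

lemma len_inv:
  assumes w: "w \<in> perms n" shows "len n (inv w) = len n w"
proof -
  let ?I = "\<lambda>w. {(a, b). a \<in> {1..n} \<and> b \<in> {1..n} \<and> a < b \<and> w b < w a}"
  note W = permsD[OF w] permsD(10)[OF permsD(5)[OF w]]
  have "bij_betw (\<lambda>(a, b). (w b, w a)) (?I w) (?I (inv w))"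
    by (rule bij_betwI[where g = "\<lambda>(a, b). (inv w b, inv w a)"])
       (use W(6,7,10,11) in \<open>auto simp del: atLeastAtMost_iff\<close>)
  then show ?thesis by (simp add: len_def bij_betw_same_card)
qed

lemma len_comp_sgen:
  assumes w: "w \<in> perms n" and i: "i \<in> {1..<n}"
  shows "len n (w \<circ> sgen i) = len n (sgen i \<circ> inv w)"
  using len_inv[of "w \<circ> sgen i" n] w i by (simp add: inv_comp_perms[where n = n])

lemma len_comp_sgen_up:
  assumes w: "w \<in> perms n" and i: "i \<in> {1..<n}" and less: "w i < w (Suc i)"
  shows "len n (w \<circ> sgen i) = Suc (len n w)"
  using len_sgen_comp_up[of "inv w" n i] w i less
  by (simp add: len_comp_sgen len_inv permsD inv_inv_eq)

lemma len_comp_sgen_down: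
  assumes w: "w \<in> perms n" and i: "i \<in> {1..<n}" and less: "w (Suc i) < w i"
  shows "Suc (len n (w \<circ> sgen i)) = len n w"
  using len_sgen_comp_down[of "inv w" n i] w i less
  by (simp add: len_comp_sgen len_inv permsD inv_inv_eq)

text \<open>Increasing values force \<open>w i\<close> >= i on {1..n}; since a permutation preserves
  the sum of {1..n}, no inequality can be strict.\<close>

lemma perms_increasing_id:
  assumes w: "w \<in> perms n" and inc: "\<And>i. i \<in> {1..<n} \<Longrightarrow> w i < w (Suc i)"
  shows "w = id"
proof -
  have ge: "i \<le> w i" if "i \<in> {1..n}" for i
    using that
  proof (induction i)
    case (Suc i)
    show ?case
    proof (cases "i = 0")
      case True
      then show ?thesis using permsD(10)[OF w, of 1] Suc.prems by simp
    next
      case False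
      then show ?thesis using Suc inc[of i] by force
    qed
  qed simp
  have eq: "w i = i" if "i \<in> {1..n}" for i
  proof (rule ccontr)
    assume ne: "w i \<noteq> i"
    have "(\<Sum>k\<in>{1..n}. k) < (\<Sum>k\<in>{1..n}. w k)"
      using ge that ne by (intro sum_strict_mono_ex1) (auto intro!: bexI[of _ i] simp: le_neq_implies_less)
    moreover have "(\<Sum>k\<in>{1..n}. w k) = (\<Sum>k\<in>{1..n}. k)"
      using sum.permute[OF permsD(1)[OF w], of "\<lambda>k. k"] by (simp add: o_def)
    ultimately show False by simp
  qed
  show ?thesis
    using eq permsD(1)[OF w] by (auto simp: fun_eq_iff permutes_def)
qed

lemma right_descent_exists:
  assumes w: "w \<in> perms n" and "w \<noteq> id"
  obtains i where "i \<in> {1..<n}" "w (Suc i) < w i"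
proof -
  obtain i where i: "i \<in> {1..<n}" "\<not> w i < w (Suc i)"
    using perms_increasing_id[OF w] assms by blast
  moreover have "w i \<noteq> w (Suc i)" using permsD(3)[OF w] by (metis injD n_not_Suc_n)
  ultimately show ?thesis using that[of i] by auto
qed

text \<open>Each step multiplies on the right and raises the length, so it matches the right action
  of a generator on basis elements. The induction is on length: a right descent of \<open>w\<close>
  gives a shorter permutation.\<close>

lemma perms_right_induct [consumes 1, case_names id step]:
  assumes "w \<in> perms n" and "P id"
    and "\<And>w i. w \<in> perms n \<Longrightarrow> i \<in> {1..<n} \<Longrightarrow> w i < w (Suc i) \<Longrightarrow> P w \<Longrightarrow> P (w \<circ> sgen i)"
  shows "P w"
  using assms(1)
proof (induction "len n w" arbitrary: w rule: less_induct)
  case less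
  show ?case
  proof (cases "w = id")
    case False
    then obtain i where i: "i \<in> {1..<n}" "w (Suc i) < w i"
      using right_descent_exists less.prems by blast
    have "len n (w \<circ> sgen i) < len n w"
      using len_comp_sgen_down[OF less.prems i] by simp
    then have "P (w \<circ> sgen i)" using less.hyps less.prems i by simp
    then have "P (w \<circ> sgen i \<circ> sgen i)"
      using less.prems i by (intro assms(3)[of "w \<circ> sgen i" i]) (simp_all add: sgen_apply)
    then show ?thesis by simp
  qed (use assms(2) in simp)
qed

section \<open>Reduced words\<close>

definition word :: "nat list \<Rightarrow> nat \<Rightarrow> nat" where
  "word is = foldr (\<lambda>i acc. sgen i \<circ> acc) is id"

lemma word_simps [simp]: "word [] = id" "word (i # is) = sgen i \<circ> word is"
  by (simp_all only: word_def foldr.simps id_apply o_apply)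

lemma reduced_word_iff:
  "reduced_word n w is \<longleftrightarrow> set is \<subseteq> {1..<n} \<and> w = word is \<and> length is = len n w"
  by (simp only: reduced_word_def word_def)

lemma word_append: "word (is @ js) = word is \<circ> word js"
  by (induction "is") (simp_all add: comp_assoc)

lemma word_perms: "set is \<subseteq> {1..<n} \<Longrightarrow> word is \<in> perms n"
  by (induction "is") auto

lemma len_id [simp]: "len n id = 0"
proof -
  have "{(i, j). i \<in> {1..n} \<and> j \<in> {1..n} \<and> i < j \<and> id j < id i} = {}" by auto
  then show ?thesis unfolding len_def by (metis card.empty)
qed

lemma len_word_le: "set is \<subseteq> {1..<n} \<Longrightarrow> len n (word is) \<le> length is"
proof (induction "is")
  case (Cons i "is")
  then have i: "i \<in> {1..<n}" and w: "word is \<in> perms n" using word_perms by auto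
  have "len n (sgen i \<circ> word is) \<le> Suc (len n (word is))"
    using len_sgen_comp_up[OF w i] len_sgen_comp_down[OF w i] inv_neq[OF w, of i]
    by linarith
  then have "len n (word (i # is)) \<le> length (i # is)" using Cons by simp
  then show ?case .
next
  case Nil
  have "len n (word []) \<le> length []" by simp
  then show ?case .
qed

lemma reduced_word_exists: "w \<in> perms n \<Longrightarrow> \<exists>is. reduced_word n w is"
proof (induction rule: perms_right_induct)
  case id
  have "reduced_word n id []" by (simp add: reduced_word_iff)
  then show ?case by blast
next
  case (step w i)
  then obtain "is" where r: "reduced_word n w is" by blast
  have "word (is @ [i]) = word is \<circ> sgen i" by (simp add: word_append)
  then have "reduced_word n (w \<circ> sgen i) (is @ [i])"
    using r step len_comp_sgen_up[of w n i] by (simp add: reduced_word_iff)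
  then show ?case by blast
qed

text \<open>One letter changes the length by one, and a word is never shorter than the length of its
  product; equality for the whole word therefore forces equality for the tail and a length increase
  at the head.\<close>

lemma reduced_word_tl:
  assumes "reduced_word n w (i # is)"
  shows "reduced_word n (word is) is" "i \<in> {1..<n}" "inv (word is) i < inv (word is) (Suc i)"
proof -
  have i: "i \<in> {1..<n}" and s: "set is \<subseteq> {1..<n}" and l: "len n (sgen i \<circ> word is) = Suc (length is)"
    using assms by (auto simp: reduced_word_iff)
  have w: "word is \<in> perms n" using word_perms[OF s] .
  have le: "len n (word is) \<le> length is" using len_word_le[OF s] .
  show i: "i \<in> {1..<n}" by fact
  show less: "inv (word is) i < inv (word is) (Suc i)"
    using len_sgen_comp_down[OF w i] l le inv_neq[OF w, of i] by linarith
  show "reduced_word n (word is) is"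
    using len_sgen_comp_up[OF w i less] l s by (simp add: reduced_word_iff)
qed

section \<open>The finite Hecke algebra\<close>

lemma hecke_eqI:
  "h \<in> hecke n \<Longrightarrow> g \<in> hecke n \<Longrightarrow> (\<And>v. v \<in> perms n \<Longrightarrow> h v = g v) \<Longrightarrow> h = g"
  by (force simp: hecke_def)

lemma hadd_hecke [simp]: "h \<in> hecke n \<Longrightarrow> g \<in> hecke n \<Longrightarrow> hadd h g \<in> hecke n"
  by (simp add: hecke_def hadd_def)

lemma hscale_hecke [simp]: "h \<in> hecke n \<Longrightarrow> hscale c h \<in> hecke n"
  by (simp add: hecke_def hscale_def)

lemma hsum_hecke: "(\<And>x. x \<in> A \<Longrightarrow> f x \<in> hecke n) \<Longrightarrow> hsum f A \<in> hecke n"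
  by (simp add: hecke_def hsum_def)

lemma hbasis_hecke [simp]: "w \<in> perms n \<Longrightarrow> hbasis w \<in> hecke n"
  by (auto simp: hecke_def hbasis_def)

lemma hone_hecke [simp]: "hone \<in> hecke n"
  by (simp add: hone_def)

lemma hecke_expand:
  assumes "h \<in> hecke n"
  shows "h = hsum (\<lambda>w. hscale (h w) (hbasis w)) (perms n)"
proof (rule ext)
  fix v
  have "(\<Sum>w\<in>perms n. h w * (if v = w then 1 else 0)) = (if v \<in> perms n then h v else 0)"
    by (simp add: if_distrib[of "\<lambda>x. _ * x"] cong: if_cong)
  then show "h v = hsum (\<lambda>w. hscale (h w) (hbasis w)) (perms n) v"
    using assms by (simp add: hsum_def hscale_def hbasis_def hecke_def)
qed

section \<open>Columns\<close>

lemma sorted_list_of_set_image: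
  fixes w :: "nat \<Rightarrow> nat"
  assumes "strict_mono_on {a..<b} w"
  shows "sorted_list_of_set (w ` {a..<b}) = map w [a..<b]"
proof -
  have "sorted_wrt (<) (map w [a..<b])"
    by (auto simp: sorted_wrt_iff_nth_less intro!: strict_mono_onD[OF assms])
  then have "sorted (map w [a..<b])" "distinct (map w [a..<b])"
    by (simp_all only: strict_sorted_iff)
  then show ?thesis
    using sorted_list_of_set.idem_if_sorted_distinct[of "map w [a..<b]"] by simp
qed

text \<open>The offset \<open>a\<close> serves both blocks of \<open>uC\<close>: 0 for the entries
  of the column, the column length for its complement.\<close>

lemma strict_mono_on_nth_sorted_list:
  fixes A :: "nat set"
  shows "strict_mono_on {Suc a..a + card A} (\<lambda>k. sorted_list_of_set A ! (k - Suc a))"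
proof (rule strict_mono_onI)
  fix r s assume "r \<in> {Suc a..a + card A}" "s \<in> {Suc a..a + card A}" "r < s"
  then have "r - Suc a < s - Suc a" "s - Suc a < length (sorted_list_of_set A)" by auto
  then show "sorted_list_of_set A ! (r - Suc a) < sorted_list_of_set A ! (s - Suc a)"
    using strict_sorted_list_of_set[of A] by (simp add: sorted_wrt_iff_nth_less)
qed

lemma bij_betw_nth_sorted_list:
  fixes A :: "nat set"
  assumes "finite A"
  shows "bij_betw (\<lambda>k. sorted_list_of_set A ! (k - Suc a)) {Suc a..a + card A} A"
proof -
  have "(\<lambda>k. sorted_list_of_set A ! (k - Suc a)) ` {Suc a..a + card A} = A" (is "?f ` _ = _")
  proof (rule set_eqI)
    fix x
    have "x \<in> A \<longleftrightarrow> (\<exists>i<card A. x = sorted_list_of_set A ! i)"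
      using assms by (metis in_set_conv_nth length_sorted_list_of_set set_sorted_list_of_set)
    also have "\<dots> \<longleftrightarrow> x \<in> ?f ` {Suc a..a + card A}"
    proof
      assume "\<exists>i<card A. x = sorted_list_of_set A ! i"
      then obtain i where "i < card A" "x = sorted_list_of_set A ! i" by blast
      then show "x \<in> ?f ` {Suc a..a + card A}" by (intro image_eqI[of _ _ "Suc a + i"]) auto
    next
      assume "x \<in> ?f ` {Suc a..a + card A}"
      then obtain k where "k \<in> {Suc a..a + card A}" "x = ?f k" by blast
      then show "\<exists>i<card A. x = sorted_list_of_set A ! i" by (intro exI[of _ "k - Suc a"]) auto
    qed
    finally show "x \<in> ?f ` {Suc a..a + card A} \<longleftrightarrow> x \<in> A" by simp
  qed
  moreover have "inj_on ?f {Suc a..a + card A}"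
    by (rule strict_mono_on_imp_inj_on) (rule strict_mono_on_nth_sorted_list)
  ultimately show ?thesis by (simp add: bij_betw_def)
qed

lemma colsD:
  assumes "C \<in> cols n l"
  shows "C \<subseteq> {1..n}" "card C = l" "finite C" "l \<le> n" "card ({1..n} - C) = n - l"
proof -
  show C: "C \<subseteq> {1..n}" "card C = l" using assms by (auto simp: cols_def)
  then show "finite C" using finite_subset by blast
  then show "l \<le> n" "card ({1..n} - C) = n - l"
    using C card_mono[of "{1..n}" C] by (auto simp: card_Diff_subset)
qed

lemma finite_cols [simp]: "finite (cols n l)"
  by (rule finite_subset[of _ "Pow {1..n}"]) (auto simp: cols_def)

lemma uC_props:
  assumes C: "C \<in> cols n l"
  shows "uC n C \<in> perms n" "uC n C ` {1..l} = C"
    "strict_mono_on {1..l} (uC n C)" "strict_mono_on {Suc l..n} (uC n C)"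
proof -
  note D = colsD[OF C]
  let ?D = "{1..n} - C"
  have nl: "{Suc l..n} = {Suc l..l + card ?D}" using D by simp
  have e1: "uC n C k = sorted_list_of_set C ! (k - Suc 0)" if "k \<in> {1..l}" for k
    using that D by (simp add: uC_def entry_def)
  have e2: "uC n C k = sorted_list_of_set ?D ! (k - Suc l)" if "k \<in> {Suc l..n}" for k
    using that D by (simp add: uC_def)
  have b1: "bij_betw (uC n C) {1..l} C"
    using bij_betw_nth_sorted_list[OF D(3), of 0] D(2) bij_betw_cong[of "{1..l}", OF e1] by simp
  have b2: "bij_betw (uC n C) {Suc l..n} ?D"
    using bij_betw_nth_sorted_list[of ?D l] bij_betw_cong[of "{Suc l..n}", OF e2]
    unfolding nl[symmetric] by simp
  have "bij_betw (uC n C) ({1..l} \<union> {Suc l..n}) (C \<union> ?D)"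
    using b1 b2 by (rule bij_betw_combine) auto
  moreover have "{1..l} \<union> {Suc l..n} = {1..n}" "C \<union> ?D = {1..n}" using D by auto
  ultimately have "bij_betw (uC n C) {1..n} {1..n}" by simp
  then show "uC n C \<in> perms n"
    unfolding perms_def mem_Collect_eq
    by (rule bij_imp_permutes) (use D in \<open>auto simp: uC_def\<close>)
  show "uC n C ` {1..l} = C" using b1 by (simp add: bij_betw_def)
  show "strict_mono_on {1..l} (uC n C)"
    using strict_mono_on_nth_sorted_list[of 0 C] D(2) e1 by (simp add: strict_mono_on_def)
  show "strict_mono_on {Suc l..n} (uC n C)"
    using strict_mono_on_nth_sorted_list[of l ?D] e2 unfolding nl[symmetric]
    by (simp add: strict_mono_on_def)
qed

text \<open>u_C is the minimal representative of its coset: listing a set in increasing order is the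
  only increasing way to fill a block, so the image of {1..l} and monotonicity on both blocks fix
  every value.\<close>

lemma uC_unique:
  assumes C: "C \<in> cols n l" and w: "w \<in> perms n" "w ` {1..l} = C"
    and sm: "strict_mono_on {1..l} w" "strict_mono_on {Suc l..n} w"
  shows "w = uC n C"
proof (rule ext)
  fix k
  note D = colsD[OF C]
  have "w ` ({1..n} - {1..l}) = {1..n} - C"
    using w permutes_image[OF permsD(1)[OF w(1)]] permsD(3)[OF w(1)] by (simp add: image_set_diff)
  moreover have "{1..n} - {1..l} = {Suc l..n}" by auto
  ultimately have im: "w ` {Suc l..<Suc n} = {1..n} - C" by (simp add: atLeastLessThanSuc_atLeastAtMost)
  have "sorted_list_of_set C = map w [1..<Suc l]"
    using sorted_list_of_set_image[of 1 "Suc l" w] sm w by (simp only: atLeastLessThanSuc_atLeastAtMost)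
  moreover have "sorted_list_of_set ({1..n} - C) = map w [Suc l..<Suc n]"
    using sorted_list_of_set_image[of "Suc l" "Suc n" w] sm im
    by (simp only: atLeastLessThanSuc_atLeastAtMost)
  moreover have "w k = k" if "k \<notin> {1..n}"
    using permsD(1)[OF w(1)] that by (simp add: permutes_def)
  ultimately show "w k = uC n C k"
    using D by (auto simp: uC_def entry_def simp del: upt_Suc)
qed

lemma highest_cols: "l \<le> n \<Longrightarrow> {1..l} \<in> cols n l"
  by (auto simp: cols_def)

lemma uC_highest: "l \<le> n \<Longrightarrow> uC n {1..l} = id"
  using uC_unique[OF highest_cols id_perms, of l n] by (simp add: strict_mono_on_def)

section \<open>Reflections of columns\<close>

lemma scol_eq: "scol j C = sgen j ` C"
  by (simp add: scol_def sgen_def)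

lemma scol_scol [simp]: "scol j (scol j C) = C"
  by (simp add: scol_eq image_image)

lemma mem_scol_iff: "x \<in> scol j C \<longleftrightarrow> sgen j x \<in> C"
  by (metis imageE image_eqI scol_eq sgen_sgen(1))

lemma mem_scol [simp]: "j \<in> scol j C \<longleftrightarrow> Suc j \<in> C" "Suc j \<in> scol j C \<longleftrightarrow> j \<in> C"
  by (simp_all add: mem_scol_iff sgen_apply)

lemma scol_fixed: "j \<in> C \<longleftrightarrow> Suc j \<in> C \<Longrightarrow> scol j C = C"
  by (auto simp: mem_scol_iff sgen_apply split: if_splits)

lemma inj_on_sgen: "inj_on (sgen j) C"
  by (metis inj_onI sgen_sgen(1))

lemma card_scol [simp]: "card (scol j C) = card C"
  unfolding scol_eq by (rule card_image) (rule inj_on_sgen)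

lemma scol_subset: "C \<subseteq> {1..n} \<Longrightarrow> j \<in> {1..<n} \<Longrightarrow> scol j C \<subseteq> {1..n}"
  by (auto simp: scol_eq sgen_apply)

lemma scol_cols: "C \<in> cols n l \<Longrightarrow> j \<in> {1..<n} \<Longrightarrow> scol j C \<in> cols n l"
  using scol_subset by (auto simp: cols_def)

text \<open>Descending from the maximum one entry at a time meets every smaller positive integer.
  The contrapositive supplies a possible move for every column that is not of highest
  weight.\<close>

lemma down_closed_column:
  assumes "C \<subseteq> {1..n}" and closed: "\<And>j. 1 \<le> j \<Longrightarrow> Suc j \<in> C \<Longrightarrow> j \<in> C"
  shows "C = {1..card C}"
proof (cases "C = {}")
  case False
  have fin: "finite C" using assms(1) finite_subset by blast
  have sub: "m - k \<in> C" if "m \<in> C" "k < m" for m k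
    using that(2)
  proof (induction k)
    case (Suc k)
    then have "Suc (m - Suc k) \<in> C" using Suc_diff_Suc[of k m] by simp
    then show ?case using closed[of "m - Suc k"] Suc.prems by simp
  qed (use that in simp)
  have down: "k \<in> C" if "m \<in> C" "1 \<le> k" "k \<le> m" for m k
    using that sub[of m "m - k"] by simp
  obtain M where "C = {1..M}"
  proof
    show "C = {1..Max C}"
    proof (intro equalityI subsetI)
      fix x assume "x \<in> C"
      then show "x \<in> {1..Max C}" using assms(1) fin by auto
    next
      fix x assume "x \<in> {1..Max C}"
      then show "x \<in> C" using down[OF Max_in[OF fin False]] by simp
    qed
  qed
  then show ?thesis by simp
qed simp

text \<open>Every column arises from the highest weight one by replacing an entry j by j+1; undoing
  such a move lowers the sum of the entries, which is the induction measure.\<close>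

lemma column_induct [consumes 1, case_names highest step]:
  assumes "C \<in> cols n l" and "P {1..l}"
    and "\<And>C j. C \<in> cols n l \<Longrightarrow> j \<in> {1..<n} \<Longrightarrow> j \<in> C \<Longrightarrow> Suc j \<notin> C \<Longrightarrow> P C \<Longrightarrow> P (scol j C)"
  shows "P C"
  using assms(1)
proof (induction "\<Sum>C" arbitrary: C rule: less_induct)
  case less
  note D = colsD[OF less.prems]
  show ?case
  proof (cases "C = {1..l}")
    case False
    then obtain j where j: "1 \<le> j" "Suc j \<in> C" "j \<notin> C"
      using down_closed_column[OF D(1)] D(2) by blast
    then have jn: "j \<in> {1..<n}" using D(1) by auto
    have "\<Sum>(scol j C) = (\<Sum>x\<in>C. sgen j x)"
      unfolding scol_eq by (subst sum.reindex[OF inj_on_sgen]) simp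
    also have "\<dots> < \<Sum>C"
      by (rule sum_strict_mono_ex1) (use j D(3) in \<open>auto simp: sgen_apply\<close>)
    finally have "P (scol j C)" using less.hyps[of "scol j C"] scol_cols[OF less.prems jn] by simp
    then have "P (scol j (scol j C))"
      using scol_cols[OF less.prems jn] jn j by (intro assms(3)[of "scol j C" j]) simp_all
    then show ?thesis by simp
  qed (use assms(2) in simp)
qed

text \<open>The only order that s_j can reverse is that of j before j+1, and these two values sit in
  different blocks of u_C. Hence s_j u_C is still increasing on both blocks and
  \<open>uC_unique\<close> applies.\<close>

lemma uC_scol:
  assumes C: "C \<in> cols n l" and j: "j \<in> {1..<n}" "j \<in> C" "Suc j \<notin> C"
  shows "uC n (scol j C) = sgen j \<circ> uC n C"
proof (rule uC_unique[symmetric])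
  note U = uC_props[OF C]
  show "scol j C \<in> cols n l" using C j by (simp add: scol_cols)
  show "sgen j \<circ> uC n C \<in> perms n" using U j by simp
  show "(sgen j \<circ> uC n C) ` {1..l} = scol j C" using U(2) by (metis image_comp scol_eq)
  have inC: "uC n C k \<in> C \<longleftrightarrow> k \<in> {1..l}" for k
    using U(2) permsD(3)[OF U(1)] by (metis inj_image_mem_iff)
  show "strict_mono_on {1..l} (sgen j \<circ> uC n C)"
  proof (rule strict_mono_onI)
    fix a b assume ab: "a \<in> {1..l}" "b \<in> {1..l}" "a < b"
    then have "uC n C a < uC n C b" "uC n C b \<noteq> Suc j"
      using strict_mono_onD[OF U(3)] inC[of b] j(3) by auto
    then show "(sgen j \<circ> uC n C) a < (sgen j \<circ> uC n C) b" by (auto intro: sgen_less)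
  qed
  show "strict_mono_on {Suc l..n} (sgen j \<circ> uC n C)"
  proof (rule strict_mono_onI)
    fix a b assume ab: "a \<in> {Suc l..n}" "b \<in> {Suc l..n}" "a < b"
    then have "uC n C a < uC n C b" "uC n C a \<noteq> j"
      using strict_mono_onD[OF U(4)] inC[of a] j(2) by auto
    then show "(sgen j \<circ> uC n C) a < (sgen j \<circ> uC n C) b" by (auto intro: sgen_less)
  qed
qed

lemma inv_less_of_image:
  assumes w: "w \<in> perms n" and j: "w ` {1..l} = C" "j \<in> C" "Suc j \<notin> C" "Suc j \<le> n"
  shows "inv w j < inv w (Suc j)"
proof -
  have "inv w j \<in> {1..l}" using j permsD(7)[OF w] by auto
  moreover have "inv w (Suc j) \<notin> {1..l}" using j permsD(6)[OF w] by (metis image_eqI)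
  moreover have "inv w (Suc j) \<in> {1..n}" using permsD(10)[OF permsD(5)[OF w]] j by simp
  ultimately show ?thesis by auto
qed

lemma stab_varpi_iff:
  assumes "l \<le> n"
  shows "v \<in> stab n (varpi l) \<longleftrightarrow> v \<in> perms n \<and> v ` {1..l} = {1..l}"
proof
  assume v: "v \<in> stab n (varpi l)"
  then have p: "v \<in> perms n" by (simp add: stab_def)
  have "v i \<in> {1..l}" if "i \<in> {1..l}" for i
  proof -
    have "varpi l (v i) = varpi l i" using v that assms by (auto simp: stab_def)
    then have "v i \<le> l" using that by (auto simp: varpi_def split: if_splits)
    then show ?thesis using permsD(10)[OF p, of i] that assms by auto
  qed
  then have "v ` {1..l} \<subseteq> {1..l}" by blast
  then have "v ` {1..l} = {1..l}"
    using permsD(3)[OF p] by (intro endo_inj_surj) (auto intro: inj_on_subset)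
  then show "v \<in> perms n \<and> v ` {1..l} = {1..l}" using p by simp
next
  assume v: "v \<in> perms n \<and> v ` {1..l} = {1..l}"
  have "v i \<le> l \<longleftrightarrow> i \<le> l" if "i \<in> {1..n}" for i
  proof -
    have "v i \<in> {1..l} \<longleftrightarrow> i \<in> {1..l}"
      using v permsD(3)[of v n] by (metis inj_image_mem_iff)
    then show ?thesis using that permsD(10)[of v n i] v by auto
  qed
  then show "v \<in> stab n (varpi l)" using v by (auto simp: stab_def varpi_def)
qed

text \<open>This identifies the left coset of u_C modulo the stabiliser of varpi_l with the
  permutations carrying {1..l} onto C; columns of length l thus index the cosets.\<close>

lemma inv_uC_comp_stab_iff:
  assumes C: "C \<in> cols n l" and w: "w \<in> perms n"
  shows "inv (uC n C) \<circ> w \<in> stab n (varpi l) \<longleftrightarrow> w ` {1..l} = C"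
proof -
  note U = uC_props[OF C]
  have "inv (uC n C) \<circ> w \<in> perms n" using U(1) w permsD(5) by blast
  moreover have "(inv (uC n C) \<circ> w) ` {1..l} = {1..l} \<longleftrightarrow> w ` {1..l} = C"
  proof
    assume "(inv (uC n C) \<circ> w) ` {1..l} = {1..l}"
    then have "uC n C ` (inv (uC n C) ` (w ` {1..l})) = C" using U(2) by (simp add: image_comp)
    then show "w ` {1..l} = C" by (simp only: image_f_inv_f[OF permsD(4)[OF U(1)]])
  next
    assume "w ` {1..l} = C"
    then have "inv (uC n C) ` (w ` {1..l}) = inv (uC n C) ` (uC n C ` {1..l})" using U(2) by simp
    then show "(inv (uC n C) \<circ> w) ` {1..l} = {1..l}"
      by (simp only: image_comp[symmetric] image_inv_f_f[OF permsD(3)[OF U(1)]])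
  qed
  ultimately show ?thesis using stab_varpi_iff[OF colsD(4)[OF C]] by simp
qed

lemma uC_comp_image:
  assumes "C \<in> cols n l" "v \<in> stab n (varpi l)"
  shows "uC n C \<circ> v \<in> perms n" "(uC n C \<circ> v) ` {1..l} = C"
proof -
  have v: "v \<in> perms n" "v ` {1..l} = {1..l}"
    using assms stab_varpi_iff[OF colsD(4)[OF assms(1)]] by auto
  then show "uC n C \<circ> v \<in> perms n" using uC_props[OF assms(1)] by blast
  show "(uC n C \<circ> v) ` {1..l} = C"
    unfolding image_comp[symmetric] v(2) using uC_props[OF assms(1)] by simp
qed

text \<open>Both values lie in one block, where u_C lists them in increasing order with nothing
  between, so their positions are adjacent. As the block does not straddle l, the resulting s_i lies
  in the stabiliser of varpi_l.\<close>

lemma fixed_index: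
  assumes C: "C \<in> cols n l" and j: "j \<in> {1..<n}" "j \<in> C \<longleftrightarrow> Suc j \<in> C"
  obtains i where "i \<in> {1..<n}" "uC n C i = j" "uC n C (Suc i) = Suc j" "i \<noteq> l"
proof -
  note U = uC_props[OF C] and P = permsD[OF uC_props(1)[OF C]]
  define i k where "i = inv (uC n C) j" and "k = inv (uC n C) (Suc j)"
  have u: "uC n C i = j" "uC n C k = Suc j" using P(6) by (simp_all add: i_def k_def)
  have inn: "i \<in> {1..n}" "k \<in> {1..n}" using P(10)[of i] P(10)[of k] u j by auto
  have inC: "uC n C k \<in> C \<longleftrightarrow> k \<in> {1..l}" for k
    using U(2) P(3) by (metis inj_image_mem_iff)
  obtain I where I: "I = {1..l} \<or> I = {Suc l..n}" "i \<in> I" "k \<in> I"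
  proof (cases "j \<in> C")
    case True
    then show ?thesis using that[of "{1..l}"] inC[of i] inC[of k] u j by simp
  next
    case False
    then show ?thesis using that[of "{Suc l..n}"] inC[of i] inC[of k] u j inn by simp
  qed
  have sm: "strict_mono_on I (uC n C)" using I(1) U(3,4) by auto
  have ik: "i < k"
  proof (rule ccontr)
    assume "\<not> i < k"
    moreover have "i \<noteq> k" using u by auto
    ultimately have "k < i" by simp
    then show False using strict_mono_onD[OF sm I(3,2)] u by simp
  qed
  have "k = Suc i"
  proof (rule ccontr)
    assume "k \<noteq> Suc i"
    then have "Suc i < k" using ik by simp
    moreover have "Suc i \<in> I" using I ik by auto
    ultimately have "uC n C i < uC n C (Suc i)" "uC n C (Suc i) < uC n C k"
      using strict_mono_onD[OF sm] I by auto
    then show False using u by simp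
  qed
  moreover have "i \<noteq> l" using I \<open>k = Suc i\<close> by auto
  ultimately show ?thesis using that[of i] u inn by simp
qed

section \<open>Column entries and the Gale order\<close>

lemma cols_card: "C \<subseteq> {1..n} \<Longrightarrow> C \<in> cols n (card C)"
  by (simp add: cols_def)

lemma strict_mono_on_entry: "strict_mono_on {1..card A} (entry A)"
  using strict_mono_on_nth_sorted_list[of 0 A] by (simp add: entry_def[abs_def])

lemma bij_betw_entry: "finite A \<Longrightarrow> bij_betw (entry A) {1..card A} A"
  using bij_betw_nth_sorted_list[of A 0] by (simp add: entry_def[abs_def])

lemma entry_highest: "k \<in> {1..m} \<Longrightarrow> entry {1..m} k = k"
proof -
  assume k: "k \<in> {1..m}"
  have "sorted_list_of_set {1..m} = map id [1..<Suc m]"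
    using sorted_list_of_set_image[of 1 "Suc m" id]
    by (simp add: strict_mono_on_def atLeastLessThanSuc_atLeastAtMost del: upt_Suc)
  then show ?thesis using k by (simp add: entry_def del: upt_Suc)
qed

lemma le_entry:
  assumes A: "A \<subseteq> {1..n}" and k: "k \<in> {1..card A}"
  shows "k \<le> entry A k"
  using k
proof (induction k)
  case (Suc k)
  have fin: "finite A" using A finite_subset by blast
  show ?case
  proof (cases "k = 0")
    case True
    have "entry A (Suc k) \<in> A" using bij_betw_apply[OF bij_betw_entry[OF fin] Suc.prems] .
    then show ?thesis using A True by auto
  next
    case False
    then have k: "k \<in> {1..card A}" using Suc.prems by simp
    have "entry A k < entry A (Suc k)"
      by (rule strict_mono_onD[OF strict_mono_on_entry k Suc.prems]) simp
    then show ?thesis using Suc.IH[OF k] by linarith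
  qed
qed simp

text \<open>Passes from the counting form of the Gale order to the entrywise one. If the k-th entry
  of B were smaller than that of A, then at the threshold \<open>entry B k\<close> the set B would
  count at least k elements and A fewer.\<close>

lemma entry_le_entry:
  assumes fin: "finite A" "finite B"
    and counts: "\<And>x. card (B \<inter> {..x}) \<le> card (A \<inter> {..x})"
    and k: "k \<in> {1..card A}" "k \<in> {1..card B}"
  shows "entry A k \<le> entry B k"
proof (rule ccontr)
  let ?x = "entry B k"
  assume "\<not> entry A k \<le> ?x"
  then have less: "?x < entry A k" by simp
  have "A \<inter> {..?x} \<subseteq> entry A ` {1..<k}"
  proof
    fix a assume a: "a \<in> A \<inter> {..?x}"
    then obtain i where i: "i \<in> {1..card A}" "a = entry A i"
      using bij_betw_imp_surj_on[OF bij_betw_entry[OF fin(1)]] by blast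
    have "i < k"
    proof (rule ccontr)
      assume "\<not> i < k"
      then have "entry A k \<le> entry A i"
        using strict_mono_onD[OF strict_mono_on_entry k(1) i(1)] by (cases "i = k") auto
      then show False using a i less by simp
    qed
    then show "a \<in> entry A ` {1..<k}" using i by auto
  qed
  then have "card (A \<inter> {..?x}) \<le> card (entry A ` {1..<k})" by (intro card_mono) auto
  also have "\<dots> \<le> card {1..<k}" by (rule card_image_le) simp
  also have "\<dots> < k" using k by simp
  finally have small: "card (A \<inter> {..?x}) < k" .
  have "entry B ` {1..k} \<subseteq> B \<inter> {..?x}"
  proof
    fix b assume "b \<in> entry B ` {1..k}"
    then obtain i where i: "i \<in> {1..k}" "b = entry B i" by blast
    then have "i \<in> {1..card B}" using k by auto
    moreover from this have "entry B i \<le> ?x"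
      using strict_mono_onD[OF strict_mono_on_entry _ k(2), of i] i by (cases "i = k") auto
    ultimately show "b \<in> B \<inter> {..?x}"
      using bij_betw_apply[OF bij_betw_entry[OF fin(2)]] i by auto
  qed
  then have "card (entry B ` {1..k}) \<le> card (B \<inter> {..?x})" using fin by (intro card_mono) auto
  moreover have "card (entry B ` {1..k}) = k"
  proof -
    have "inj_on (entry B) {1..k}"
      using k(2) by (intro inj_on_subset[OF bij_betw_imp_inj_on[OF bij_betw_entry[OF fin(2)]]]) simp
    then show ?thesis by (simp add: card_image)
  qed
  ultimately show False using small counts[of ?x] by simp
qed

lemma card_scol_Int_atMost:
  assumes "x \<noteq> j" shows "card (scol j C \<inter> {..x}) = card (C \<inter> {..x})"
proof -
  have "sgen j y \<le> x \<longleftrightarrow> y \<le> x" for y using assms by (auto simp: sgen_apply)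
  then have "scol j C \<inter> {..x} = scol j (C \<inter> {..x})"
    by (intro set_eqI) (simp add: mem_scol_iff)
  then show ?thesis by simp
qed

lemma card_scol_Int_atMost_le:
  assumes "finite C" "j \<in> C" "Suc j \<notin> C"
  shows "card (scol j C \<inter> {..x}) \<le> card (C \<inter> {..x})"
proof (cases "x = j")
  case True
  have "scol j C \<inter> {..j} \<subseteq> C \<inter> {..j}"
  proof
    fix y assume y: "y \<in> scol j C \<inter> {..j}"
    then have "y \<noteq> j" "y \<noteq> Suc j" using assms(3) by auto
    then show "y \<in> C \<inter> {..j}" using y by (simp add: mem_scol_iff sgen_apply)
  qed
  then show ?thesis using True assms by (simp add: card_mono)
qed (simp add: card_scol_Int_atMost)

text \<open>A reflection affects only the count at threshold j. There s_jC does not contain j, so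
  its count is already reached at j-1, a threshold at which E and s_jE agree.\<close>

lemma card_scol_Int_atMost_mono:
  assumes "finite E" "1 \<le> j" "Suc j \<notin> C"
    and le: "\<And>x. card (C \<inter> {..x}) \<le> card (scol j E \<inter> {..x})"
  shows "card (scol j C \<inter> {..x}) \<le> card (E \<inter> {..x})"
proof (cases "x = j")
  case True
  have "scol j C \<inter> {..j} = C \<inter> {..j - 1}"
  proof (rule set_eqI)
    fix y
    consider "y < j" | "y = j" | "y > j" by linarith
    moreover have "y \<le> j - 1 \<longleftrightarrow> y < j" using assms(2) by linarith
    ultimately show "y \<in> scol j C \<inter> {..j} \<longleftrightarrow> y \<in> C \<inter> {..j - 1}"
      using assms(3) by cases (simp_all add: mem_scol_iff sgen_apply)
  qed
  then have "card (scol j C \<inter> {..j}) \<le> card (scol j E \<inter> {..j - 1})" using le by simp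
  also have "\<dots> = card (E \<inter> {..j - 1})" using assms(2) by (intro card_scol_Int_atMost) simp
  also have "\<dots> \<le> card (E \<inter> {..j})" using assms(1) by (intro card_mono) auto
  finally show ?thesis using True by simp
next
  case False
  then show ?thesis using le[of x] by (simp add: card_scol_Int_atMost)
qed

section \<open>The Hecke action\<close>

text \<open>The parameter lives in any commutative ring; \<open>t dvd 1\<close> says that it is
  invertible, which makes every T_i invertible.\<close>

locale hecke_unit =
  fixes t :: "'a::comm_ring_1" and n :: nat
  assumes t_unit: "t dvd 1"
begin

abbreviation L :: "nat \<Rightarrow> 'a hecke \<Rightarrow> 'a hecke" where
  "L \<equiv> hgen_mult t n"

text \<open>Right multiplication by T_j in coefficient form, with the length test written as a
  comparison of adjacent values.\<close>

definition R :: "nat \<Rightarrow> 'a hecke \<Rightarrow> 'a hecke" where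
  "R j h = (\<lambda>v. if v \<in> perms n then
      (if v (Suc j) < v j then h (v \<circ> sgen j) + (t - 1) * h v else t * h (v \<circ> sgen j)) else 0)"

definition bar :: "nat \<Rightarrow> 'a hecke \<Rightarrow> 'a hecke" where
  "bar i h = hadd (L i h) (hscale (1 - t) h)"

lemma L_apply:
  assumes "v \<in> perms n" "i \<in> {1..<n}"
  shows "L i h v = (if inv v (Suc i) < inv v i then h (sgen i \<circ> v) + (t - 1) * h v
    else t * h (sgen i \<circ> v))"
  using assms by (simp add: hgen_mult_def len_sgen_comp_less_iff)

lemma L_hecke [simp]: "L i h \<in> hecke n"
  by (simp add: hecke_def hgen_mult_def)

lemma R_hecke [simp]: "R i h \<in> hecke n"
  by (simp add: hecke_def R_def)

lemma bar_hecke [simp]: "h \<in> hecke n \<Longrightarrow> bar i h \<in> hecke n"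
  by (simp add: bar_def)

lemma inv_sgen_comp: "v \<in> perms n \<Longrightarrow> i \<in> {1..<n} \<Longrightarrow> inv (sgen i \<circ> v) = inv v \<circ> sgen i"
  by (simp add: inv_comp_perms[where n = n])

lemma inv_comp_sgen: "v \<in> perms n \<Longrightarrow> i \<in> {1..<n} \<Longrightarrow> inv (v \<circ> sgen i) = sgen i \<circ> inv v"
  by (simp add: inv_comp_perms[where n = n])

text \<open>T_i mixes only the coefficients at v and s_i v, so the quadratic relation is checked on
  this pair. It exhibits \<open>bar i\<close> as t times the inverse of \<open>L i\<close>.\<close>

lemma L_bar:
  assumes h: "h \<in> hecke n" and i: "i \<in> {1..<n}"
  shows "L i (bar i h) = hscale t h"
proof (rule hecke_eqI[where n = n])
  fix v assume v: "v \<in> perms n"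
  then have sv: "sgen i \<circ> v \<in> perms n" using i by simp
  show "L i (bar i h) v = hscale t h v"
    using inv_neq[OF v, of i] i
    by (auto simp: L_apply[OF v i] L_apply[OF sv i] bar_def hadd_def hscale_def
        inv_sgen_comp[OF v i] sgen_apply algebra_simps)
qed (use h in auto)

lemma L_hadd: "L i (hadd g h) = hadd (L i g) (L i h)"
  by (auto simp: hgen_mult_def hadd_def fun_eq_iff algebra_simps)

lemma L_hscale: "L i (hscale c h) = hscale c (L i h)"
  by (auto simp: hgen_mult_def hscale_def fun_eq_iff algebra_simps)

lemma L_hsum: "L i (hsum f A) = hsum (\<lambda>x. L i (f x)) A"
  by (auto simp: hgen_mult_def hsum_def fun_eq_iff sum_distrib_left sum.distrib)

lemma bar_L: "h \<in> hecke n \<Longrightarrow> i \<in> {1..<n} \<Longrightarrow> bar i (L i h) = hscale t h"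
  by (metis L_bar bar_def L_hadd L_hscale)

lemma L_quadratic:
  assumes "h \<in> hecke n" "i \<in> {1..<n}"
  shows "L i (L i h) = hadd (hscale (t - 1) (L i h)) (hscale t h)"
  using bar_L[OF assms]
  by (auto simp: bar_def hadd_def hscale_def fun_eq_iff algebra_simps)

text \<open>Left and right multiplication commute; consequently an operator composed of left
  multiplications is determined by its value at the unit, which makes the choice of reduced
  words irrelevant without any appeal to Matsumoto's theorem.\<close>

lemma L_R_commute:
  assumes i: "i \<in> {1..<n}" and j: "j \<in> {1..<n}"
  shows "L i (R j h) = R j (L i h)"
proof (rule hecke_eqI[where n = n])
  fix v assume v: "v \<in> perms n"
  have sv: "sgen i \<circ> v \<in> perms n" and vs: "v \<circ> sgen j \<in> perms n"
    using i j v by simp_all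
  note V = permsD[OF v]
  note simps = L_apply[OF v i] L_apply[OF vs i] inv_comp_sgen[OF v j] R_def v sv comp_assoc
  have ne: "v j \<noteq> v (Suc j)" using V(3) by (metis injD n_not_Suc_n)
  \<comment> \<open>If v carries {j, j+1} onto {i, i+1}, then s_i v = v s_j and both operators act
    on the same pair of coefficients. Otherwise neither multiplication disturbs the length test of
    the other.\<close>
  consider "v j = i" "v (Suc j) = Suc i" | "v j = Suc i" "v (Suc j) = i" | "{v j, v (Suc j)} \<noteq> {i, Suc i}"
    by (metis doubleton_eq_iff)
  then show "L i (R j h) v = R j (L i h) v"
  proof cases
    case 1
    then have i': "inv v i = j" "inv v (Suc i) = Suc j" using V(7)[of j] V(7)[of "Suc j"] by simp_all
    have eq: "sgen i \<circ> v = v \<circ> sgen j"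
      using 1 V(3) by (intro sgen_comp_eq_comp_sgen) auto
    have "sgen i \<circ> (v \<circ> sgen j) = v"
      by (subst eq[symmetric]) (rule sgen_sgen(3))
    then show ?thesis using eq 1 i' vs by (simp add: simps sgen_apply)
  next
    case 2
    then have i': "inv v i = Suc j" "inv v (Suc i) = j" using V(7)[of j] V(7)[of "Suc j"] by simp_all
    have eq: "sgen i \<circ> v = v \<circ> sgen j"
      using 2 V(3) by (intro sgen_comp_eq_comp_sgen) auto
    have "sgen i \<circ> (v \<circ> sgen j) = v"
      by (subst eq[symmetric]) (rule sgen_sgen(3))
    then show ?thesis using eq 2 i' vs by (simp add: simps sgen_apply)
  next
    case 3
    have b: "sgen i (v (Suc j)) < sgen i (v j) \<longleftrightarrow> v (Suc j) < v j"
      using 3 ne by (intro sgen_less_iff) auto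
    have "{inv v i, inv v (Suc i)} \<noteq> {j, Suc j}"
      using 3 V(6)[of i] V(6)[of "Suc i"] by (auto simp: doubleton_eq_iff)
    then have a: "sgen j (inv v (Suc i)) < sgen j (inv v i) \<longleftrightarrow> inv v (Suc i) < inv v i"
      using inv_neq[OF v, of i] by (intro sgen_less_iff) auto
    show ?thesis
      using a b by (simp add: simps algebra_simps)
  qed
qed auto

section \<open>Products of left generators and the action of T_w\<close>

abbreviation Ls :: "nat list \<Rightarrow> 'a hecke \<Rightarrow> 'a hecke" where
  "Ls is \<equiv> foldr L is"

lemma Ls_hecke: "h \<in> hecke n \<Longrightarrow> Ls is h \<in> hecke n"
  by (cases "is") auto

lemma Ls_R: "set is \<subseteq> {1..<n} \<Longrightarrow> j \<in> {1..<n} \<Longrightarrow> Ls is (R j h) = R j (Ls is h)"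
  by (induction "is") (auto simp: L_R_commute)

lemma Ls_hscale: "Ls is (hscale c h) = hscale c (Ls is h)"
  by (induction "is") (auto simp: L_hscale)

lemma Ls_hsum: "Ls is (hsum f A) = hsum (\<lambda>x. Ls is (f x)) A"
  by (induction "is") (auto simp: L_hsum)

lemma L_hbasis_up:
  assumes w: "w \<in> perms n" and i: "i \<in> {1..<n}" and less: "inv w i < inv w (Suc i)"
  shows "L i (hbasis w) = hbasis (sgen i \<circ> w)"
proof (rule hecke_eqI[where n = n])
  fix v assume v: "v \<in> perms n"
  have ne: "sgen i \<circ> w \<noteq> w" using len_sgen_comp_up[OF assms] by auto
  have "sgen i \<circ> v = w \<longleftrightarrow> v = sgen i \<circ> w" by (metis sgen_sgen(3))
  then show "L i (hbasis w) v = hbasis (sgen i \<circ> w) v"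
    using less ne
    by (auto simp: L_apply[OF v i] hbasis_def inv_sgen_comp[OF w i] sgen_apply)
qed (use w i in auto)

lemma R_hbasis_up:
  assumes w: "w \<in> perms n" and i: "i \<in> {1..<n}" and less: "w i < w (Suc i)"
  shows "R i (hbasis w) = hbasis (w \<circ> sgen i)"
proof (rule hecke_eqI[where n = n])
  fix v assume v: "v \<in> perms n"
  have ne: "w \<circ> sgen i \<noteq> w" using len_comp_sgen_up[OF assms] by auto
  have "v \<circ> sgen i = w \<longleftrightarrow> v = w \<circ> sgen i" by (metis sgen_sgen(4))
  then show "R i (hbasis w) v = hbasis (w \<circ> sgen i) v"
    using less ne v by (auto simp: R_def hbasis_def sgen_apply)
qed (use w i in auto)

lemma Ls_hone: "reduced_word n w is \<Longrightarrow> Ls is hone = hbasis w"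
proof (induction "is" arbitrary: w)
  case Nil
  then have "Ls [] hone = hbasis w" by (simp add: reduced_word_iff hone_def)
  then show ?case .
next
  case (Cons i "is")
  note r = reduced_word_tl[OF Cons.prems]
  have "word is \<in> perms n" using r(1) word_perms by (auto simp: reduced_word_iff)
  then have "Ls (i # is) hone = hbasis w"
    using Cons.IH[OF r(1)] L_hbasis_up[of "word is" i] r Cons.prems
    by (simp add: reduced_word_iff)
  then show ?case .
qed

text \<open>Both words send T_id to T_w, every T_v is obtained from T_id by right multiplications,
  and these commute with left ones; linearity gives the rest.\<close>

lemma Ls_independent:
  assumes "reduced_word n w is" "reduced_word n w js" and h: "h \<in> hecke n"
  shows "Ls is h = Ls js h"
proof -
  have s: "set is \<subseteq> {1..<n}" "set js \<subseteq> {1..<n}" using assms by (auto simp: reduced_word_iff)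
  have basis: "Ls is (hbasis v) = Ls js (hbasis v)" if "v \<in> perms n" for v
    using that
  proof (induction rule: perms_right_induct)
    case id
    have "Ls is (hbasis id) = Ls js (hbasis id)"
      using Ls_hone[OF assms(1)] Ls_hone[OF assms(2)] by (simp add: hone_def)
    then show ?case .
  next
    case (step v i)
    then show ?case using R_hbasis_up[OF step(1-3)] s by (metis Ls_R)
  qed
  have "Ls is h = hsum (\<lambda>w. hscale (h w) (Ls is (hbasis w))) (perms n)"
    by (subst hecke_expand[OF h]) (simp add: Ls_hsum Ls_hscale)
  also have "\<dots> = hsum (\<lambda>w. hscale (h w) (Ls js (hbasis w))) (perms n)"
    by (simp add: hsum_def hscale_def basis)
  also have "\<dots> = Ls js h"
    by (subst (2) hecke_expand[OF h]) (simp add: Ls_hsum Ls_hscale)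
  finally show ?thesis .
qed

abbreviation LW :: "(nat \<Rightarrow> nat) \<Rightarrow> 'a hecke \<Rightarrow> 'a hecke" where
  "LW \<equiv> hbasis_mult t n"

text \<open>Replaces the word picked by \<open>SOME\<close> in \<open>hbasis_mult\<close> by any
  reduced word at hand.\<close>

lemma LW_reduced: "reduced_word n w is \<Longrightarrow> h \<in> hecke n \<Longrightarrow> LW w h = Ls is h"
  unfolding hbasis_mult_def by (rule Ls_independent[OF someI])

lemma LW_hecke: "h \<in> hecke n \<Longrightarrow> LW w h \<in> hecke n"
  by (simp add: hbasis_mult_def Ls_hecke)

lemma LW_id: "h \<in> hecke n \<Longrightarrow> LW id h = h"
  using LW_reduced[of id "[]"] by (simp add: reduced_word_iff)

lemma LW_left_up:
  assumes w: "w \<in> perms n" and i: "i \<in> {1..<n}" and less: "inv w i < inv w (Suc i)"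
    and h: "h \<in> hecke n"
  shows "LW (sgen i \<circ> w) h = L i (LW w h)"
proof -
  obtain "is" where r: "reduced_word n w is" using reduced_word_exists[OF w] by blast
  then have "reduced_word n (sgen i \<circ> w) (i # is)"
    using len_sgen_comp_up[OF w i less] i by (simp add: reduced_word_iff)
  then show ?thesis using LW_reduced[OF _ h] r by simp
qed

lemma LW_right_up:
  assumes w: "w \<in> perms n" and i: "i \<in> {1..<n}" and less: "w i < w (Suc i)"
    and h: "h \<in> hecke n"
  shows "LW (w \<circ> sgen i) h = LW w (L i h)"
proof -
  obtain "is" where r: "reduced_word n w is" using reduced_word_exists[OF w] by blast
  then have "reduced_word n (w \<circ> sgen i) (is @ [i])"
    using len_comp_sgen_up[OF w i less] i by (simp add: reduced_word_iff word_append)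
  then show ?thesis using LW_reduced[OF _ h] LW_reduced[OF r, of "L i h"] by simp
qed

lemma LW_sgen: "i \<in> {1..<n} \<Longrightarrow> h \<in> hecke n \<Longrightarrow> LW (sgen i) h = L i h"
  using LW_left_up[of id i h] by (simp add: LW_id)

lemma hmult_hbasis:
  assumes w: "w \<in> perms n" shows "hmult t n (hbasis w) h = LW w h"
proof (rule ext)
  fix v
  have "hmult t n (hbasis w) h v = (\<Sum>u\<in>perms n. if u = w then LW u h v else 0)"
    unfolding hmult_def hbasis_def by (intro sum.cong) auto
  then show "hmult t n (hbasis w) h v = LW w h v" using w by simp
qed

lemma hmult_hecke: "h \<in> hecke n \<Longrightarrow> hmult t n g h \<in> hecke n"
  using LW_hecke by (simp add: hmult_def hecke_def)

text \<open>Associativity for a generator as left factor: (T_i g) h = T_i (g h). Iterated in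
  \<open>hmult_Ls\<close>, it turns a solution of T_w g = 1 into a solution of T_w x = h for every
  h.\<close>

lemma hmult_L:
  assumes h: "h \<in> hecke n" and i: "i \<in> {1..<n}"
  shows "hmult t n (L i g) h = L i (hmult t n g h)"
proof (rule ext)
  fix v
  let ?D = "\<lambda>w. inv w (Suc i) < inv w i"
  have LLW: "L i (LW w h) = (if ?D w then hadd (hscale (t - 1) (LW w h)) (hscale t (LW (sgen i \<circ> w) h))
      else LW (sgen i \<circ> w) h)" if w: "w \<in> perms n" for w
  proof (cases "?D w")
    case True
    then have "LW w h = L i (LW (sgen i \<circ> w) h)"
      using LW_left_up[of "sgen i \<circ> w" i h] w i h by (simp add: inv_sgen_comp sgen_apply)
    then show ?thesis using True L_quadratic[OF LW_hecke[OF h] i, of "sgen i \<circ> w"] by simp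
  next
    case False
    then show ?thesis using LW_left_up[OF w i _ h] inv_neq[OF w, of i] by simp
  qed
  have bij: "bij_betw (\<lambda>w. sgen i \<circ> w) (perms n) (perms n)"
    by (rule bij_betwI[where g = "\<lambda>w. sgen i \<circ> w"]) (use i in auto)
  \<comment> \<open>The coefficients of T_i g split into a part moved by s_i, which is reindexed
    below by w -> s_i w, and the diagonal part with factor t - 1.\<close>
  have "hmult t n (L i g) h v = (\<Sum>w\<in>perms n. (if ?D w then g (sgen i \<circ> w) else t * g (sgen i \<circ> w)) * LW w h v)
      + (\<Sum>w\<in>perms n. if ?D w then (t - 1) * g w * LW w h v else 0)"
    unfolding hmult_def sum.distrib[symmetric]
    by (intro sum.cong) (auto simp: L_apply[OF _ i] algebra_simps)
  also have "(\<Sum>w\<in>perms n. (if ?D w then g (sgen i \<circ> w) else t * g (sgen i \<circ> w)) * LW w h v)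
      = (\<Sum>w\<in>perms n. (if ?D w then t * g w else g w) * LW (sgen i \<circ> w) h v)"
  proof (subst sum.reindex_bij_betw[OF bij, symmetric], intro sum.cong refl)
    fix w assume w: "w \<in> perms n"
    then show "(if ?D (sgen i \<circ> w) then g (sgen i \<circ> (sgen i \<circ> w)) else t * g (sgen i \<circ> (sgen i \<circ> w)))
        * LW (sgen i \<circ> w) h v = (if ?D w then t * g w else g w) * LW (sgen i \<circ> w) h v"
      using inv_neq[OF w, of i] by (auto simp: inv_sgen_comp[OF w i] sgen_apply)
  qed
  also have "\<dots> + (\<Sum>w\<in>perms n. if ?D w then (t - 1) * g w * LW w h v else 0)
      = (\<Sum>w\<in>perms n. g w * L i (LW w h) v)"
    unfolding sum.distrib[symmetric]
    by (intro sum.cong) (auto simp: LLW hadd_def hscale_def algebra_simps)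
  also have "\<dots> = hsum (\<lambda>w. L i (hscale (g w) (LW w h))) (perms n) v"
    by (simp add: hsum_def L_hscale) (simp add: hscale_def)
  also have "\<dots> = L i (hsum (\<lambda>w. hscale (g w) (LW w h)) (perms n)) v"
    by (simp add: L_hsum)
  also have "hsum (\<lambda>w. hscale (g w) (LW w h)) (perms n) = hmult t n g h"
    by (simp add: hsum_def hscale_def hmult_def)
  finally show "hmult t n (L i g) h v = L i (hmult t n g h) v" .
qed

lemma hmult_Ls:
  "h \<in> hecke n \<Longrightarrow> set is \<subseteq> {1..<n} \<Longrightarrow> hmult t n (Ls is g) h = Ls is (hmult t n g h)"
  by (induction "is") (auto simp: hmult_L)

lemma hmult_hone: "h \<in> hecke n \<Longrightarrow> hmult t n hone h = h"
  by (simp add: hone_def hmult_hbasis LW_id)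

section \<open>Invertibility of the generators and of T_w\<close>

lemma hscale_inverse:
  obtains t' where "\<And>h::'a hecke. hscale t' (hscale t h) = h"
proof -
  obtain t' where "1 = t * t'" using t_unit by (rule dvdE)
  then have t': "t' * t = 1" by (simp add: mult.commute)
  have "hscale t' (hscale t h) = h" for h :: "'a hecke"
    by (simp add: hscale_def t' mult.assoc[symmetric])
  then show ?thesis using that by blast
qed

lemma L_inj: "i \<in> {1..<n} \<Longrightarrow> g \<in> hecke n \<Longrightarrow> h \<in> hecke n \<Longrightarrow> L i g = L i h \<Longrightarrow> g = h"
  by (metis bar_L hscale_inverse)

lemma L_surj:
  assumes "i \<in> {1..<n}" "h \<in> hecke n"
  shows "\<exists>g\<in>hecke n. L i g = h"
proof -
  obtain t' where t': "\<And>h::'a hecke. hscale t' (hscale t h) = h" by (rule hscale_inverse) blast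
  have "L i (hscale t' (bar i h)) = hscale t' (hscale t h)"
    using assms by (simp add: L_hscale L_bar)
  also have "\<dots> = h" by (rule t')
  finally show ?thesis using assms by (intro bexI[of _ "hscale t' (bar i h)"]) auto
qed

lemma Ls_inj:
  "set is \<subseteq> {1..<n} \<Longrightarrow> g \<in> hecke n \<Longrightarrow> h \<in> hecke n \<Longrightarrow> Ls is g = Ls is h \<Longrightarrow> g = h"
proof (induction "is")
  case (Cons i "is")
  then show ?case using L_inj[of i "Ls is g" "Ls is h"] by (simp add: Ls_hecke)
qed simp

lemma Ls_surj: "set is \<subseteq> {1..<n} \<Longrightarrow> h \<in> hecke n \<Longrightarrow> \<exists>g\<in>hecke n. Ls is g = h"
proof (induction "is" arbitrary: h)
  case (Cons i "is")
  then obtain g where "g \<in> hecke n" "L i g = h" using L_surj[of i h] by auto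
  then show ?case using Cons.IH[of g] Cons.prems by auto
qed simp

lemma LW_inj:
  assumes "w \<in> perms n" "g \<in> hecke n" "h \<in> hecke n" "LW w g = LW w h"
  shows "g = h"
proof -
  obtain "is" where r: "reduced_word n w is" using reduced_word_exists[OF assms(1)] by blast
  then have "Ls is g = Ls is h" "set is \<subseteq> {1..<n}"
    using assms by (auto simp: LW_reduced reduced_word_iff)
  then show ?thesis using Ls_inj assms by blast
qed

text \<open>Solving T_w g = 1 letter by letter gives a right inverse; it is also a left inverse
  because left multiplication by T_w is injective, and injectivity gives the uniqueness that
  \<open>THE\<close> in \<open>hinv\<close> demands.\<close>

lemma LW_hinv:
  assumes w: "w \<in> perms n" and h: "h \<in> hecke n"
  shows "LW w (hmult t n (hinv t n (hbasis w)) h) = h"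
proof -
  obtain "is" where r: "reduced_word n w is" using reduced_word_exists[OF w] by blast
  then have s: "set is \<subseteq> {1..<n}" by (simp add: reduced_word_iff)
  obtain g where g: "g \<in> hecke n" "Ls is g = hone"
    using Ls_surj[OF s hone_hecke] by blast
  have gx: "Ls is (hmult t n g x) = x" if "x \<in> hecke n" for x
    using hmult_Ls[OF that s, of g] g that by (simp add: hmult_hone)
  have "Ls is (hmult t n g (hbasis w)) = Ls is hone"
    using gx[of "hbasis w"] w Ls_hone[OF r] by simp
  then have "hmult t n g (hbasis w) = hone"
    using Ls_inj[OF s] w by (simp add: hmult_hecke)
  moreover have "hmult t n (hbasis w) g = hone"
    using w g r by (simp add: hmult_hbasis LW_reduced)
  ultimately have "hinv t n (hbasis w) = g"
    unfolding hinv_def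
  proof (intro the_equality)
    fix g' assume "g' \<in> hecke n \<and> hmult t n (hbasis w) g' = hone \<and> hmult t n g' (hbasis w) = hone"
    then show "g' = g"
      using \<open>hmult t n (hbasis w) g = hone\<close> g(1) LW_inj[OF w, of g' g] w
      by (simp add: hmult_hbasis)
  qed (use g in auto)
  then show ?thesis using gx[OF h] r hmult_hecke[OF h] by (simp add: LW_reduced[OF r])
qed

lemma hscale_hinv_sgen:
  assumes j: "j \<in> {1..<n}" and h: "h \<in> hecke n"
  shows "hscale t (hmult t n (hinv t n (hbasis (sgen j))) h) = bar j h"
proof (rule L_inj[OF j])
  let ?x = "hmult t n (hinv t n (hbasis (sgen j))) h"
  have "L j ?x = h" using LW_hinv[of "sgen j" h] LW_sgen[OF j, of ?x] j h by (simp add: hmult_hecke)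
  then show "L j (hscale t ?x) = L j (bar j h)" using j h by (simp add: L_hscale L_bar)
qed (use h in \<open>auto simp: hmult_hecke\<close>)

section \<open>Components and the operators attached to columns\<close>

text \<open>Lengths add along the coset, T_{u_C} T_v = T_{u_C v} for v in the stabiliser, so T_{u_C}
  merely translates coefficients. Each move C -> s_jC lengthens every element of the coset of C,
  hence T_j creates neither a factor t nor a term with t - 1.\<close>

lemma LW_uC:
  assumes C: "C \<in> cols n l" and g: "g \<in> hpar n (varpi l)"
  shows "LW (uC n C) g = (\<lambda>w. g (inv (uC n C) \<circ> w))"
  using C
proof (induction rule: column_induct)
  case highest
  have "LW (uC n {1..l}) g = (\<lambda>w. g (inv (uC n {1..l}) \<circ> w))"
    using g colsD(4)[OF C] by (simp add: uC_highest[simplified] LW_id hpar_def)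
  then show ?case .
next
  case (step C j)
  note U = uC_props[OF step(1)] and j = step(2-4)
  have gh: "g \<in> hecke n" using g by (simp add: hpar_def)
  let ?f = "\<lambda>w. g (inv (uC n C) \<circ> w)"
  have supp: "?f x = 0" if "x \<in> perms n" "x ` {1..l} \<noteq> C" for x
    using inv_uC_comp_stab_iff[OF step(1) that(1)] that(2) g by (simp add: hpar_def)
  have "LW (uC n (scol j C)) g = L j (LW (uC n C) g)"
    unfolding uC_scol[OF step(1-4)]
    by (rule LW_left_up[OF U(1) j(1) inv_less_of_image[OF U(1,2) j(2,3)] gh]) (use j in simp)
  also have "\<dots> = L j ?f" by (rule arg_cong[OF step.IH])
  also have "\<dots> = (\<lambda>w. g (inv (uC n (scol j C)) \<circ> w))"
  proof (rule hecke_eqI[where n = n])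
    have inv: "inv (uC n (scol j C)) = inv (uC n C) \<circ> sgen j"
      unfolding uC_scol[OF step(1-4)] by (rule inv_sgen_comp[OF U(1) j(1)])
    have "w \<in> perms n" if "inv (uC n (scol j C)) \<circ> w \<in> perms n" for w
      using inv_comp_permsD[OF uC_props(1)[OF scol_cols[OF step(1) j(1)]] that] .
    then show "(\<lambda>w. g (inv (uC n (scol j C)) \<circ> w)) \<in> hecke n"
      using gh unfolding hecke_def by blast
    fix v assume v: "v \<in> perms n"
    then have sv: "sgen j \<circ> v \<in> perms n" using j by simp
    have "L j ?f v = ?f (sgen j \<circ> v)"
    proof (cases "inv v (Suc j) < inv v j")
      case True
      then have "v ` {1..l} \<noteq> C" using inv_less_of_image[OF v _ j(2,3), of l] j(1) by auto
      then show ?thesis using True supp[OF v] by (simp add: L_apply[OF v j(1)])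
    next
      case False
      then have "(sgen j \<circ> v) ` {1..l} \<noteq> C"
        using inv_less_of_image[OF sv _ j(2,3), of l] j(1)
        unfolding inv_sgen_comp[OF v j(1)] by (auto simp: sgen_apply simp del: image_comp)
      then show ?thesis using False supp[OF sv] by (simp add: L_apply[OF v j(1)])
    qed
    then show "L j ?f v = g (inv (uC n (scol j C)) \<circ> v)" by (simp add: inv comp_assoc)
  qed simp
  finally have "LW (uC n (scol j C)) g = (\<lambda>w. g (inv (uC n (scol j C)) \<circ> w))" .
  then show ?case .
qed

text \<open>Closed form of \<open>component\<close>: the coefficients of h on the coset of u_C,
  pulled back to the stabiliser.\<close>

definition comp_at :: "nat set \<Rightarrow> 'a hecke \<Rightarrow> 'a hecke" where
  "comp_at C h = (\<lambda>v. if v \<in> stab n (varpi (card C)) then h (uC n C \<circ> v) else 0)"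

lemma stab_perms: "v \<in> stab n lam \<Longrightarrow> v \<in> perms n"
  by (simp add: stab_def)

lemma comp_at_hpar [simp]: "comp_at C h \<in> hpar n (varpi (card C))"
  by (auto simp: comp_at_def hpar_def hecke_def stab_perms)

lemma comp_at_hecke [simp]: "comp_at C h \<in> hecke n"
  using comp_at_hpar[of C h] unfolding hpar_def by blast

lemma hpar_translate_sum:
  assumes f: "\<And>F. F \<in> cols n l \<Longrightarrow> f F \<in> hpar n (varpi l)"
    and F: "F \<in> cols n l" and w: "w \<in> perms n" "w ` {1..l} = F"
  shows "(\<Sum>G\<in>cols n l. f G (inv (uC n G) \<circ> w)) = f F (inv (uC n F) \<circ> w)"
proof -
  have "(\<Sum>G\<in>cols n l. f G (inv (uC n G) \<circ> w))
      = (\<Sum>G\<in>cols n l. if G = F then f G (inv (uC n G) \<circ> w) else 0)"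
  proof (intro sum.cong refl)
    fix G assume G: "G \<in> cols n l"
    show "f G (inv (uC n G) \<circ> w) = (if G = F then f G (inv (uC n G) \<circ> w) else 0)"
      using inv_uC_comp_stab_iff[OF G w(1)] w(2) f[OF G] by (simp add: hpar_def)
  qed
  then show ?thesis using F by simp
qed

text \<open>By \<open>LW_uC\<close> the summand for F occupies exactly the coset of u_F. The cosets
  partition the symmetric group, so the decomposition exists and its coefficients can be read off
  from h.\<close>

lemma component_eq:
  assumes C: "C \<in> cols n l" and h: "h \<in> hecke n"
  shows "component t n l h C = comp_at C h"
proof -
  have sum: "hsum (\<lambda>F. hmult t n (hbasis (uC n F)) (f F)) (cols n l)
      = (\<lambda>w. \<Sum>F\<in>cols n l. f F (inv (uC n F) \<circ> w))"
    if "\<forall>F\<in>cols n l. f F \<in> hpar n (varpi l)" for f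
  proof (unfold hsum_def, intro ext sum.cong refl)
    fix w F assume F: "F \<in> cols n l"
    then show "hmult t n (hbasis (uC n F)) (f F) w = f F (inv (uC n F) \<circ> w)"
      using that by (simp add: hmult_hbasis[OF uC_props(1)[OF F]] LW_uC[OF F])
  qed
  \<comment> \<open>The value \<open>hzero\<close> away from the columns of length l is the one
    prescribed in \<open>component\<close>; it makes the family unique as a function on all
    sets.\<close>
  define f where "f = (\<lambda>F. if F \<in> cols n l then comp_at F h else hzero)"
  have fpar: "f F \<in> hpar n (varpi l)" if "F \<in> cols n l" for F
    using that comp_at_hpar[of F h] colsD(2)[OF that] by (simp add: f_def)
  have "component t n l h = f"
    unfolding component_def
  proof (rule the_equality, intro conjI)
    show "\<forall>F\<in>cols n l. f F \<in> hpar n (varpi l)" using fpar by blast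
    show "\<forall>F. F \<notin> cols n l \<longrightarrow> f F = hzero" by (simp add: f_def)
    have "h w = (\<Sum>F\<in>cols n l. f F (inv (uC n F) \<circ> w))" for w
    proof (cases "w \<in> perms n")
      case True
      let ?F = "w ` {1..l}"
      have F: "?F \<in> cols n l"
      proof -
        have "w ` {1..l} \<subseteq> w ` {1..n}" using colsD(4)[OF C] by (intro image_mono) simp
        moreover have "w ` {1..n} = {1..n}" using permutes_image[OF permsD(1)[OF True]] .
        moreover have "card (w ` {1..l}) = l"
          using card_image[OF inj_on_subset[OF permsD(3)[OF True] subset_UNIV], of "{1..l}"] by simp
        ultimately show ?thesis by (simp add: cols_def)
      qed
      have "inv (uC n ?F) \<circ> w \<in> stab n (varpi l)" using inv_uC_comp_stab_iff[OF F True] by simp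
      moreover have "uC n ?F \<circ> (inv (uC n ?F) \<circ> w) = w"
        using permsD(8)[OF uC_props(1)[OF F]] by (simp add: o_assoc)
      ultimately have "f ?F (inv (uC n ?F) \<circ> w) = h w"
        using F colsD(2)[OF F] by (simp add: f_def comp_at_def)
      then show ?thesis using hpar_translate_sum[OF fpar F True refl] by simp
    next
      case False
      have "f F (inv (uC n F) \<circ> w) = 0" if F: "F \<in> cols n l" for F
      proof (rule ccontr)
        assume "f F (inv (uC n F) \<circ> w) \<noteq> 0"
        then have "inv (uC n F) \<circ> w \<in> perms n" using fpar[OF F] unfolding hpar_def hecke_def by blast
        then show False using False inv_comp_permsD[OF uC_props(1)[OF F]] by blast
      qed
      then show ?thesis using False h by (simp add: hecke_def)
    qed
    then show "h = hsum (\<lambda>F. hmult t n (hbasis (uC n F)) (f F)) (cols n l)"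
      by (subst sum) (use fpar in blast, rule ext)
  next
    fix f' assume f': "(\<forall>F\<in>cols n l. f' F \<in> hpar n (varpi l)) \<and> (\<forall>F. F \<notin> cols n l \<longrightarrow> f' F = hzero)
      \<and> h = hsum (\<lambda>F. hmult t n (hbasis (uC n F)) (f' F)) (cols n l)"
    then have h': "h w = (\<Sum>F\<in>cols n l. f' F (inv (uC n F) \<circ> w))" for w
      using sum[of f'] by simp
    show "f' = f"
    proof (intro ext)
      fix F v
      show "f' F v = f F v"
      proof (cases "F \<in> cols n l \<and> v \<in> stab n (varpi l)")
        case True
        then have F: "F \<in> cols n l" and v: "v \<in> stab n (varpi l)" by auto
        have "inv (uC n F) \<circ> (uC n F \<circ> v) = v"
          using permsD(9)[OF uC_props(1)[OF F]] by (simp add: o_assoc)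
        then have "h (uC n F \<circ> v) = f' F v"
          unfolding h' using hpar_translate_sum[of l f' F, OF _ F uC_comp_image[OF F v]] f' by simp
        then show ?thesis using F v colsD(2)[OF F] by (simp add: f_def comp_at_def)
      next
        case False
        then consider "F \<notin> cols n l" | "F \<in> cols n l" "v \<notin> stab n (varpi l)" by blast
        then show ?thesis
        proof cases
          case 1
          then show ?thesis using f' by (simp add: f_def)
        next
          case 2
          then have "f' F \<in> hpar n (varpi l)" "f F \<in> hpar n (varpi l)" using f' fpar by blast+
          then show ?thesis using 2 by (simp add: hpar_def)
        qed
      qed
    qed
  qed
  then show ?thesis using C by (simp add: f_def)
qed

text \<open>By \<open>B_highest\<close> and \<open>B_scol\<close> this operator is the product of
  the \<open>bar j\<close> along a reduced word of u_C.\<close>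

definition B :: "nat set \<Rightarrow> 'a hecke \<Rightarrow> 'a hecke" where
  "B C h = hscale (t ^ len n (uC n C)) (hmult t n (hinv t n (hbasis (inv (uC n C)))) h)"

lemma B_hecke [simp]: "h \<in> hecke n \<Longrightarrow> B C h \<in> hecke n"
  by (simp add: B_def hmult_hecke)

lemma LW_hscale: "LW w (hscale c h) = hscale c (LW w h)"
  by (simp add: hbasis_mult_def Ls_hscale)

lemma LW_hsum: "LW w (hsum f A) = hsum (\<lambda>x. LW w (f x)) A"
  by (simp add: hbasis_mult_def Ls_hsum)

lemma Ls_hadd: "Ls is (hadd g h) = hadd (Ls is g) (Ls is h)"
  by (induction "is") (auto simp: L_hadd)

lemma LW_hadd: "LW w (hadd g h) = hadd (LW w g) (LW w h)"
  by (simp add: hbasis_mult_def Ls_hadd)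

lemma LW_B:
  assumes "C \<in> cols n l" "h \<in> hecke n"
  shows "LW (inv (uC n C)) (B C h) = hscale (t ^ len n (uC n C)) h"
  using LW_hinv[OF permsD(5)[OF uC_props(1)[OF assms(1)]] assms(2)] by (simp add: B_def LW_hscale)

text \<open>Identities for \<open>B\<close> are all checked after applying T_w with w the inverse of
  u_C: this is injective and cancels the inverse in the definition.\<close>

lemma B_unique:
  assumes "C \<in> cols n l" "h \<in> hecke n" "x \<in> hecke n"
    and "LW (inv (uC n C)) x = hscale (t ^ len n (uC n C)) h"
  shows "B C h = x"
  using LW_inj[OF permsD(5)[OF uC_props(1)[OF assms(1)]], of "B C h" x] assms LW_B[OF assms(1,2)]
  by simp

lemma B_highest:
  assumes "l \<le> n" "h \<in> hecke n"
  shows "B {1..l} h = h"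
  using B_unique[OF highest_cols[OF assms(1)] assms(2) assms(2)] assms
  by (simp add: uC_highest[simplified] LW_id hscale_def)

text \<open>The inverse of u_{s_jC} = s_j u_C is u_C^{-1} s_j with lengths adding. The extra T_j
  meets \<open>bar j\<close> and produces the one additional factor t.\<close>

lemma B_scol:
  assumes C: "C \<in> cols n l" and j: "j \<in> {1..<n}" "j \<in> C" "Suc j \<notin> C" and h: "h \<in> hecke n"
  shows "B (scol j C) h = bar j (B C h)"
proof (rule B_unique[OF scol_cols[OF C j(1)] h])
  note U = uC_props[OF C]
  have iu: "inv (uC n C) j < inv (uC n C) (Suc j)"
    using inv_less_of_image[OF U(1,2) j(2,3)] j(1) by simp
  have "inv (uC n (scol j C)) = inv (uC n C) \<circ> sgen j"
    unfolding uC_scol[OF C j] by (rule inv_sgen_comp[OF U(1) j(1)])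
  then have "LW (inv (uC n (scol j C))) (bar j (B C h)) = LW (inv (uC n C)) (L j (bar j (B C h)))"
    using LW_right_up[OF permsD(5)[OF U(1)] j(1) iu, of "bar j (B C h)"] h by simp
  also have "\<dots> = hscale t (hscale (t ^ len n (uC n C)) h)"
    using h j by (simp add: L_bar LW_hscale LW_B[OF C])
  also have "\<dots> = hscale (t ^ len n (uC n (scol j C))) h"
    unfolding uC_scol[OF C j] len_sgen_comp_up[OF U(1) j(1) iu]
    by (simp add: hscale_def mult.assoc)
  finally show "LW (inv (uC n (scol j C))) (bar j (B C h)) = hscale (t ^ len n (uC n (scol j C))) h" .
qed (use h in simp)

lemma bar_hscale: "bar i (hscale c h) = hscale c (bar i h)"
  by (simp add: bar_def L_hscale) (simp add: hadd_def hscale_def fun_eq_iff algebra_simps)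

lemma hscale_hscale: "hscale a (hscale b h) = hscale (a * b) h"
  by (simp add: hscale_def mult.assoc)

lemma B_hadd:
  assumes "C \<in> cols n l" "g \<in> hecke n" "h \<in> hecke n"
  shows "B C (hadd g h) = hadd (B C g) (B C h)"
  by (rule B_unique[OF assms(1)])
     (use assms in \<open>simp_all add: LW_hadd LW_B[OF assms(1)]\<close>,
      simp add: hadd_def hscale_def fun_eq_iff algebra_simps)

lemma B_hscale:
  assumes "C \<in> cols n l" "h \<in> hecke n"
  shows "B C (hscale c h) = hscale c (B C h)"
  by (rule B_unique[OF assms(1)])
     (use assms in \<open>simp_all add: LW_hscale LW_B[OF assms(1)] hscale_hscale mult.commute\<close>)

lemma B_hsum:
  assumes C: "C \<in> cols n l" and f: "\<And>x. x \<in> A \<Longrightarrow> f x \<in> hecke n"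
  shows "B C (hsum f A) = hsum (\<lambda>x. B C (f x)) A"
proof (rule B_unique[OF C])
  have "LW (inv (uC n C)) (hsum (\<lambda>x. B C (f x)) A) = hsum (\<lambda>x. LW (inv (uC n C)) (B C (f x))) A"
    by (rule LW_hsum)
  also have "\<dots> = hsum (\<lambda>x. hscale (t ^ len n (uC n C)) (f x)) A"
    unfolding hsum_def by (intro ext sum.cong) (simp_all add: LW_B[OF C f])
  also have "\<dots> = hscale (t ^ len n (uC n C)) (hsum f A)"
    by (simp add: hsum_def hscale_def sum_distrib_left)
  finally show "LW (inv (uC n C)) (hsum (\<lambda>x. B C (f x)) A)
      = hscale (t ^ len n (uC n C)) (hsum f A)" .
qed (use f in \<open>auto intro!: hsum_hecke\<close>)

section \<open>Components under addition, scaling and the action of T_j\<close>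

lemma comp_at_hadd: "comp_at C (hadd g h) = hadd (comp_at C g) (comp_at C h)"
  by (auto simp: comp_at_def hadd_def)

lemma comp_at_hscale: "comp_at C (hscale c h) = hscale c (comp_at C h)"
  by (auto simp: comp_at_def hscale_def)

lemma comp_at_hsum: "comp_at C (hsum f A) = hsum (\<lambda>x. comp_at C (f x)) A"
  by (auto simp: comp_at_def hsum_def)

text \<open>Throughout the coset of u_C left multiplication by s_j raises the length, so the
  coefficient of T_j h is t times the one on the coset of s_jC.\<close>

lemma comp_at_L_down:
  assumes C: "C \<in> cols n l" and j: "j \<in> {1..<n}" "j \<in> C" "Suc j \<notin> C"
  shows "comp_at C (L j h) = hscale t (comp_at (scol j C) h)"
proof (rule ext)
  fix v
  note l = colsD(2)[OF C]
  show "comp_at C (L j h) v = hscale t (comp_at (scol j C) h) v"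
  proof (cases "v \<in> stab n (varpi l)")
    case True
    note u = uC_comp_image[OF C True]
    have "inv (uC n C \<circ> v) j < inv (uC n C \<circ> v) (Suc j)"
      using inv_less_of_image[OF u j(2,3)] j(1) by simp
    then show ?thesis
      using True by (simp add: comp_at_def l hscale_def L_apply[OF u(1) j(1)] uC_scol[OF C j] comp_assoc)
  qed (simp add: comp_at_def l hscale_def)
qed

text \<open>Here s_j lowers the length on the coset of u_C, and the diagonal term (t - 1) h produced
  by T_j cancels against the summand (1 - t) h of \<open>bar j\<close>.\<close>

lemma comp_at_bar_up:
  assumes C: "C \<in> cols n l" and j: "j \<in> {1..<n}" "j \<notin> C" "Suc j \<in> C"
  shows "comp_at C (bar j h) = comp_at (scol j C) h"
proof (rule ext)
  fix v
  note l = colsD(2)[OF C]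
  let ?S = "scol j C"
  have S: "?S \<in> cols n l" "j \<in> ?S" "Suc j \<notin> ?S" using scol_cols[OF C j(1)] j by auto
  have uC: "uC n C = sgen j \<circ> uC n ?S" using uC_scol[OF S(1) j(1) S(2,3)] by simp
  show "comp_at C (bar j h) v = comp_at ?S h v"
  proof (cases "v \<in> stab n (varpi l)")
    case True
    note u = uC_comp_image[OF C True] and uS = uC_comp_image[OF S(1) True]
    have eq: "sgen j \<circ> (uC n C \<circ> v) = uC n ?S \<circ> v" unfolding uC by (simp add: comp_assoc)
    have "inv (uC n ?S \<circ> v) j < inv (uC n ?S \<circ> v) (Suc j)"
      using inv_less_of_image[OF uS S(2,3)] j(1) by simp
    then have "inv (uC n C \<circ> v) (Suc j) < inv (uC n C \<circ> v) j"
      unfolding eq[symmetric] inv_sgen_comp[OF u(1) j(1)] by (simp add: sgen_apply)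
    then show ?thesis
      using True
      by (simp add: comp_at_def l bar_def hadd_def hscale_def L_apply[OF u(1) j(1)] eq algebra_simps)
  qed (simp add: comp_at_def l)
qed

text \<open>With i from \<open>fixed_index\<close> one has s_j u_C = u_C s_i. Taking the component
  turns \<open>bar j\<close> into \<open>bar i\<close> inside the parabolic subalgebra, and
  \<open>B C\<close> turns it back into \<open>bar j\<close>.\<close>

lemma fixed_column:
  assumes C: "C \<in> cols n l" and j: "j \<in> {1..<n}" "j \<in> C \<longleftrightarrow> Suc j \<in> C"
  shows "\<exists>i. (\<forall>h. comp_at C (bar j h) = bar i (comp_at C h)) \<and> (\<forall>h\<in>hecke n. B C (bar i h) = bar j (B C h))"
proof -
  obtain i where i: "i \<in> {1..<n}" "uC n C i = j" "uC n C (Suc i) = Suc j" "i \<noteq> l"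
    using fixed_index[OF C j] by blast
  note U = uC_props[OF C] and P = permsD[OF uC_props(1)[OF C]] and l = colsD(2)[OF C]
  have iu: "inv (uC n C) j = i" "inv (uC n C) (Suc j) = Suc i" using i(2,3) P(7)[of i] P(7)[of "Suc i"] by simp_all
  have "comp_at C (L j h) = L i (comp_at C h)" for h
  proof (rule hecke_eqI[where n = n])
    fix v assume v: "v \<in> perms n"
    have siff: "sgen i \<circ> v \<in> stab n (varpi l) \<longleftrightarrow> v \<in> stab n (varpi l)"
    proof -
      have "varpi l (sgen i x) = varpi l x" for x using i(4) by (auto simp: varpi_def sgen_apply)
      then show ?thesis using i(1) by (simp add: stab_def)
    qed
    show "comp_at C (L j h) v = L i (comp_at C h) v"
    proof (cases "v \<in> stab n (varpi l)")
      case True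
      note u = uC_comp_image[OF C True]
      have "inv (uC n C \<circ> v) j = inv v i" "inv (uC n C \<circ> v) (Suc j) = inv v (Suc i)"
        using inv_comp_perms[OF U(1) v] iu by simp_all
      moreover have "sgen j \<circ> (uC n C \<circ> v) = uC n C \<circ> (sgen i \<circ> v)"
        using sgen_comp_eq_comp_sgen[OF P(3), of i j] i by (simp add: o_assoc)
      ultimately show ?thesis
        using True siff by (simp add: comp_at_def l L_apply[OF u(1) j(1)] L_apply[OF v i(1)])
    next
      case False
      then show ?thesis using siff by (simp add: comp_at_def l L_apply[OF v i(1)])
    qed
  qed simp_all
  then have "comp_at C (bar j h) = bar i (comp_at C h)" for h
    by (simp add: bar_def comp_at_hadd comp_at_hscale)
  moreover have "B C (bar i h) = bar j (B C h)" if h: "h \<in> hecke n" for h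
  proof (rule B_unique[OF C])
    have LL: "LW (inv (uC n C)) (L j x) = L i (LW (inv (uC n C)) x)" if x: "x \<in> hecke n" for x
    proof -
      have "inv (uC n C) \<circ> sgen j = sgen i \<circ> inv (uC n C)"
        using sgen_comp_eq_comp_sgen[OF permsD(3)[OF P(5)], of j i] iu by simp
      then show ?thesis
        using LW_right_up[OF P(5) j(1) _ x] LW_left_up[OF P(5) i(1) _ x] iu i(2,3) P(2)
        by (simp add: inv_inv_eq)
    qed
    have "LW (inv (uC n C)) (bar j (B C h)) = bar i (LW (inv (uC n C)) (B C h))"
      using h by (simp add: bar_def LW_hadd LW_hscale LL)
    also have "\<dots> = hscale (t ^ len n (uC n C)) (bar i h)"
      using h by (simp add: LW_B[OF C] bar_hscale)
    finally show "LW (inv (uC n C)) (bar j (B C h)) = hscale (t ^ len n (uC n C)) (bar i h)" .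
  qed (use h in auto)
  ultimately show ?thesis by blast
qed

lemma one_lam_hecke [simp]: "one_lam n lam \<in> hecke n"
  by (simp add: one_lam_def hecke_def stab_def)

lemma hzero_hecke [simp]: "hzero \<in> hecke n"
  by (simp add: hzero_def hecke_def)

text \<open>Starting the recursion with the sum of all \<open>T\<^sub>w\<close> (that is, \<open>\<mu> = 0\<close>) makes the
  one-column case an instance of the recursive one.\<close>

primrec Phi :: "nat set list \<Rightarrow> 'a hecke" where
  "Phi [] = one_lam n (\<lambda>_. 0)"
| "Phi (C # S) = B C (comp_at C (Phi S))"

lemma Phi_hecke [simp]: "Phi S \<in> hecke n"
  by (cases S) auto

lemma comp_at_one_zero:
  assumes "C \<subseteq> {1..n}"
  shows "comp_at C (one_lam n (\<lambda>_. 0)) = one_lam n (varpi (card C))"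
proof (rule ext)
  fix v
  have "stab n (\<lambda>_. 0) = perms n" by (simp add: stab_def)
  then show "comp_at C (one_lam n (\<lambda>_. 0)) v = one_lam n (varpi (card C)) v"
    using uC_comp_image(1)[OF cols_card[OF assms], of v]
    by (auto simp add: comp_at_def one_lam_def)
qed

lemma Psi_eq_Phi: "T \<noteq> [] \<Longrightarrow> \<forall>C\<in>set T. C \<subseteq> {1..n} \<Longrightarrow> Psi t n T = Phi T"
proof (induction T)
  case (Cons C S)
  show ?case
  proof (cases S)
    case Nil
    then have "Psi t n [C] = Phi [C]" using Cons.prems by (simp add: B_def comp_at_one_zero)
    then show ?thesis using Nil by simp
  next
    case S: (Cons D S')
    then have IH: "Psi t n (D # S') = Phi (D # S')" using Cons.IH Cons.prems by simp
    have "C \<in> cols n (card C)" using Cons.prems by (intro cols_card) simp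
    then have "component t n (card C) (Phi (D # S')) C = comp_at C (Phi (D # S'))"
      by (intro component_eq Phi_hecke)
    then have "Psi t n (C # D # S') = B C (comp_at C (Phi (D # S')))"
      using IH by (simp only: Psi.simps B_def)
    then show ?thesis unfolding S Phi.simps(2)[of C] .
  qed
qed simp

section \<open>Vanishing on tableaux that are not semistandard\<close>

text \<open>Building D from {1..m}, each move applies one \<open>bar j\<close>, which either keeps w
  or replaces it by s_j w. In the first case the move only lowers the counts of the column; the
  second is \<open>card_scol_Int_atMost_mono\<close>.\<close>

lemma B_support:
  assumes D: "D \<in> cols n m" and h: "h \<in> hpar n (varpi m)"
    and w: "w \<in> perms n" "B D h w \<noteq> 0"
  shows "card (D \<inter> {..x}) \<le> card (w ` {1..m} \<inter> {..x})"
proof -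
  have hh: "h \<in> hecke n" using h by (simp add: hpar_def)
  have "\<forall>w x. w \<in> perms n \<longrightarrow> B D h w \<noteq> 0 \<longrightarrow> card (D \<inter> {..x}) \<le> card (w ` {1..m} \<inter> {..x})"
    using D
  proof (induction rule: column_induct)
    case highest
    have "card ({1..m} \<inter> {..x}) \<le> card (w ` {1..m} \<inter> {..x})"
      if "w \<in> perms n" "B {1..m} h w \<noteq> 0" for w x
    proof -
      have "h w \<noteq> 0" using that B_highest[OF colsD(4)[OF D] hh] by simp
      then have "w \<in> stab n (varpi m)" using h unfolding hpar_def by blast
      then have "w ` {1..m} = {1..m}" using stab_varpi_iff[OF colsD(4)[OF D]] by blast
      then show ?thesis by simp
    qed
    then show ?case by blast
  next
    case (step C j)
    have "card (scol j C \<inter> {..x}) \<le> card (w ` {1..m} \<inter> {..x})"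
      if w: "w \<in> perms n" "B (scol j C) h w \<noteq> 0" for w x
    proof -
      have sw: "sgen j \<circ> w \<in> perms n" using w step(2) by simp
      have "bar j (B C h) w \<noteq> 0" using w B_scol[OF step(1-4) hh] by simp
      then have "B C h w \<noteq> 0 \<or> B C h (sgen j \<circ> w) \<noteq> 0"
        by (auto simp: bar_def hadd_def hscale_def L_apply[OF w(1) step(2)] split: if_splits)
      then show ?thesis
      proof
        assume "B C h w \<noteq> 0"
        then have "card (C \<inter> {..x}) \<le> card (w ` {1..m} \<inter> {..x})" using step.IH w by blast
        then show ?thesis
          using card_scol_Int_atMost_le[OF colsD(3)[OF step(1)] step(3,4), of x] by linarith
      next
        \<comment> \<open>The induction hypothesis is used at s_j w, whose image of {1..m} is the
          reflection of that of w, and for all thresholds at once.\<close>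
        assume "B C h (sgen j \<circ> w) \<noteq> 0"
        then have "card (C \<inter> {..x}) \<le> card (scol j (w ` {1..m}) \<inter> {..x})" for x
          using step.IH sw unfolding scol_eq image_comp by blast
        then show ?thesis
          using step(2,4) by (intro card_scol_Int_atMost_mono) auto
      qed
    qed
    then show ?case by blast
  qed
  then show ?thesis using w by blast
qed

text \<open>A nonzero coefficient sits at some w with \<open>w\<close>
  {1..l}\<open>= C. As m <= l, the set\<close>w \<open>{1..m}\<close> is contained in C, so
  \<open>B_support\<close> puts D above C entrywise, against the assumption at row k.\<close>

lemma comp_at_B_eq_hzero:
  assumes C: "C \<in> cols n l" and D: "D \<in> cols n m" and ml: "m \<le> l"
    and h: "h \<in> hpar n (varpi m)"
    and k: "k \<in> {1..m}" "\<not> entry C k \<le> entry D k"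
  shows "comp_at C (B D h) = hzero"
proof (rule ccontr)
  assume "comp_at C (B D h) \<noteq> hzero"
  then obtain v where "comp_at C (B D h) v \<noteq> 0" by (auto simp: hzero_def fun_eq_iff)
  then have v: "v \<in> stab n (varpi l)" "B D h (uC n C \<circ> v) \<noteq> 0"
    using colsD(2)[OF C] by (auto simp: comp_at_def split: if_splits)
  note u = uC_comp_image[OF C v(1)]
  have "card (D \<inter> {..x}) \<le> card (C \<inter> {..x})" for x
  proof -
    have "card (D \<inter> {..x}) \<le> card ((uC n C \<circ> v) ` {1..m} \<inter> {..x})"
      using B_support[OF D h u(1) v(2)] .
    also have "\<dots> \<le> card (C \<inter> {..x})"
    proof (rule card_mono)
      have "(uC n C \<circ> v) ` {1..m} \<subseteq> (uC n C \<circ> v) ` {1..l}" using ml by (intro image_mono) simp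
      then show "(uC n C \<circ> v) ` {1..m} \<inter> {..x} \<subseteq> C \<inter> {..x}" using u(2) by blast
    qed simp
    finally show ?thesis .
  qed
  then have "entry C k \<le> entry D k"
    using k(1) ml colsD(2,3)[OF C] colsD(2,3)[OF D] by (intro entry_le_entry) auto
  then show False using k(2) by simp
qed

lemma B_hzero: "C \<subseteq> {1..n} \<Longrightarrow> B C hzero = hzero"
  using B_hscale[OF cols_card hzero_hecke, of C 0] by (simp add: hscale_def hzero_def)

lemma comp_at_hzero: "comp_at C hzero = hzero"
  by (auto simp: comp_at_def hzero_def)

lemma Phi_append_hzero:
  "Phi S = hzero \<Longrightarrow> \<forall>C\<in>set P. C \<subseteq> {1..n} \<Longrightarrow> Phi (P @ S) = hzero"
proof (induction P)
  case (Cons C P)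
  then have "Phi ((C # P) @ S) = hzero" by (simp add: comp_at_hzero B_hzero)
  then show ?case .
qed simp

lemma Phi_not_semistandard:
  assumes T: "\<forall>C\<in>set T. C \<subseteq> {1..n}" "sorted_wrt (\<lambda>C D. card D \<le> card C) T"
    and ns: "\<not> semistandard T"
  shows "Phi T = hzero"
proof -
  obtain i k where i: "Suc i < length T" and k: "k \<in> {1..card (T ! Suc i)}"
    "\<not> entry (T ! i) k \<le> entry (T ! Suc i) k"
    using ns by (auto simp: semistandard_def)
  let ?C = "T ! i" and ?D = "T ! Suc i" and ?S = "drop (Suc (Suc i)) T"
  \<comment> \<open>One bad adjacent pair suffices: the component at its left column is zero, and
    zero propagates through all columns further left.\<close>
  have eq: "T = take i T @ ?C # ?D # ?S"
    using id_take_nth_drop[of i T] Cons_nth_drop_Suc[of "Suc i" T] i by simp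
  have C: "?C \<in> cols n (card ?C)" and D: "?D \<in> cols n (card ?D)"
    using T(1) i nth_mem[of i T] nth_mem[of "Suc i" T] by (simp_all add: cols_card)
  have "card ?D \<le> card ?C" using T(2) i by (auto simp: sorted_wrt_iff_nth_less)
  then have "comp_at ?C (Phi (?D # ?S)) = hzero"
    using comp_at_B_eq_hzero[OF C D _ comp_at_hpar k] by simp
  then have "Phi (?C # ?D # ?S) = hzero" using T i by (simp add: B_hzero)
  then have "Phi (take i T @ ?C # ?D # ?S) = hzero"
    using T by (intro Phi_append_hzero) (auto dest: in_set_takeD)
  then show ?thesis using eq by simp
qed

section \<open>Highest weight tableaux\<close>

text \<open>For a highest weight column u_C is the identity and \<open>B C\<close> does nothing, so
  adding the column only cuts the support down to the stabiliser of varpi_l. The stabiliser of the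
  new shape is the intersection.\<close>

lemma Phi_highest_weight:
  "\<forall>C\<in>set T. C \<subseteq> {1..n} \<Longrightarrow> sorted_wrt (\<lambda>C D. card D \<le> card C) T \<Longrightarrow> highest_weight T
    \<Longrightarrow> Phi T = one_lam n (shape T)"
proof (induction T)
  case Nil
  have "Phi [] = one_lam n (shape [])" by (simp add: shape_def)
  then show ?case .
next
  case (Cons C T)
  let ?l = "card C"
  have C: "C = {1..?l}" "?l \<le> n"
    using Cons.prems cols_card[of C n] colsD(4)[of C n ?l] by (simp_all add: highest_weight_def)
  have le: "card D \<le> ?l" if "D \<in> set T" for D using Cons.prems that by simp
  have T: "Phi T = one_lam n (shape T)" using Cons by (simp add: highest_weight_def)
  have sh: "shape (C # T) i = varpi ?l i + shape T i" for i by (simp add: shape_def varpi_def)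
  have sh0: "shape T i = 0" if "?l < i" for i
    using le that by (force simp: shape_def filter_empty_conv)
  have nonneg: "0 \<le> shape T i" for i by (simp add: shape_def)
  \<comment> \<open>For a <= l < b the summed shape is at least 1 at a and 0 at b, so no
    cancellation between varpi_l and the old shape is possible.\<close>
  have iff: "shape (C # T) a = shape (C # T) b \<longleftrightarrow> varpi ?l a = varpi ?l b \<and> shape T a = shape T b"
    for a b
    using sh0[of a] sh0[of b] nonneg[of a] nonneg[of b] unfolding sh varpi_def
    by (cases "a \<le> ?l"; cases "b \<le> ?l") auto
  have st: "v \<in> stab n (shape (C # T)) \<longleftrightarrow> v \<in> stab n (varpi ?l) \<and> v \<in> stab n (shape T)" for v
    unfolding stab_def iff by blast
  have "uC n C = id" using uC_highest[OF C(2)] unfolding C(1)[symmetric] .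
  then have "comp_at C (Phi T) = one_lam n (shape (C # T))"
    unfolding T comp_at_def one_lam_def st by (intro ext) simp
  moreover have "B C h = h" if "h \<in> hecke n" for h 
    using B_highest[OF C(2) that] unfolding C(1)[symmetric] .
  ultimately have "Phi (C # T) = one_lam n (shape (C # T))" by simp
  then show ?case .
qed

section \<open>The recursion\<close>

definition act :: "int \<Rightarrow> nat \<Rightarrow> 'a hecke \<Rightarrow> 'a hecke" where
  "act s j h = (if s = -1 then L j h else bar j h)"

lemma act_hecke [simp]: "h \<in> hecke n \<Longrightarrow> act s j h \<in> hecke n"
  by (simp add: act_def)

text \<open>T_j and its bar version differ by the scalar t - 1; this is the source of every
  correction term in (c).\<close>

lemma act_switch:
  assumes "s = 1 \<or> s = -1" "s' = 1 \<or> s' = -1"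
  shows "act s j h = hadd (act s' j h) (hscale (if s * s' = -1 then of_int s * (1 - t) else 0) h)"
  using assms by (auto simp: act_def bar_def hadd_def hscale_def fun_eq_iff algebra_simps)

text \<open>When j or j+1 alone lies in C, one of the two factors supplies the reflection and the
  other the operator: for sign -1 the factor t from the component turns B_C into T_j B_{s_jC}, for
  sign 1 \<open>B_scol\<close> yields \<open>bar j\<close>. If s_jC = C, the operator passes through
  by \<open>fixed_column\<close>.\<close>

lemma B_comp_at_act:
  assumes C: "C \<in> cols n l" and j: "j \<in> {1..<n}" and Q: "Q \<in> hecke n"
  shows "B C (comp_at C (act (sigma j C) j Q))
    = act (sigma j C) j (B (scol j C) (comp_at (scol j C) Q))"
proof -
  let ?S = "scol j C"
  consider "j \<in> C" "Suc j \<notin> C" | "j \<notin> C" "Suc j \<in> C" | "j \<in> C \<longleftrightarrow> Suc j \<in> C" by blast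
  then show ?thesis
  proof cases
    case 1
    then have s: "sigma j C = -1" by (simp add: sigma_def)
    have "L j (B ?S (comp_at ?S Q)) = hscale t (B C (comp_at ?S Q))"
      using B_scol[OF C j 1] j by (simp add: L_bar)
    then show ?thesis
      using s comp_at_L_down[OF C j 1] B_hscale[OF C] by (simp add: act_def)
  next
    case 2
    then have s: "sigma j C = 1" by (simp add: sigma_def)
    have "B C (comp_at ?S Q) = bar j (B ?S (comp_at ?S Q))"
      using B_scol[OF scol_cols[OF C j] j, of "comp_at ?S Q"] 2 by simp
    then show ?thesis using s comp_at_bar_up[OF C j 2] by (simp add: act_def)
  next
    case 3
    then have s: "sigma j C = 1" by (simp add: sigma_def)
    obtain i where "\<forall>h. comp_at C (bar j h) = bar i (comp_at C h)"
      "\<forall>h\<in>hecke n. B C (bar i h) = bar j (B C h)"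
      using fixed_column[OF C j 3] by blast
    then show ?thesis using s scol_fixed[OF 3] by (simp add: act_def)
  qed
qed

lemma sigma_cases: "sigma j C = 1 \<or> sigma j C = -1"
  by (simp add: sigma_def)

text \<open>A coefficient that vanishes where the sign does not change lets the induction sum over a
  full interval; \<open>hsum_hscale_filter\<close> recovers the restricted sum.\<close>

definition coef :: "nat \<Rightarrow> nat set list \<Rightarrow> nat \<Rightarrow> 'a" where
  "coef j T k = (if sigma j (colk T k) * sigma j (colk T (Suc k)) = -1
    then of_int (sigma j (colk T k)) * (1 - t) else 0)"

text \<open>Columns are numbered from the right, so prepending one on the left keeps all
  indices.\<close>

lemma colk_Cons: "k \<le> length T \<Longrightarrow> 1 \<le> k \<Longrightarrow> colk (C # T) k = colk T k"
  by (simp add: colk_def Suc_diff_le)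

lemma Omega_Cons: "k \<le> length T \<Longrightarrow> Omega j k (C # T) = C # Omega j k T"
  by (simp add: Omega_def Suc_diff_le)

lemma Omega_length: "Omega j (length T) T = map (scol j) T"
  by (simp add: Omega_def)

text \<open>As s_j fixes \<open>lam\<close>, left multiplication by s_j preserves the support of
  \<open>one_lam n lam\<close>, and it carries the coset of s_jC to that of C.\<close>

lemma comp_at_one_invariant:
  assumes C: "C \<in> cols n l" and j: "j \<in> {1..<n}" "j \<notin> C" "Suc j \<in> C" and lam: "lam j = lam (Suc j)"
  shows "comp_at C (one_lam n lam) = comp_at (scol j C) (one_lam n lam)"
proof -
  have S: "scol j C \<in> cols n l" "j \<in> scol j C" "Suc j \<notin> scol j C"
    using scol_cols[OF C j(1)] j by auto
  have uC: "uC n C = sgen j \<circ> uC n (scol j C)" using uC_scol[OF S(1) j(1) S(2,3)] by simp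
  have "lam (sgen j x) = lam x" for x using lam by (simp add: sgen_apply)
  then have "sgen j \<circ> w \<in> stab n lam \<longleftrightarrow> w \<in> stab n lam" for w
    using j(1) by (simp add: stab_def)
  then show ?thesis
    by (simp add: comp_at_def one_lam_def uC comp_assoc fun_eq_iff)
qed

lemma hsum_Suc: "hsum f {1..<Suc m} = hadd (hsum f {1..<m}) (f m)" if "1 \<le> m"
  using that by (simp add: hsum_def hadd_def)

lemma hadd_assoc: "hadd (hadd f g) h = hadd f (hadd g h)"
  and hadd_commute: "hadd g h = hadd h g"
  by (simp_all add: hadd_def add_ac)

text \<open>The induction adds columns on the left while \<open>X\<close> stays fixed. The operator
  left by the old head is traded for the one matching the sign of the new column, which passes
  through; the cost of the trade is the summand with k equal to the old number of columns.\<close>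

lemma Phi_recursion:
  assumes j: "j \<in> {1..<n}" and X: "Phi X = one_lam n lam" "lam j = lam (Suc j)"
  shows "T \<noteq> [] \<Longrightarrow> \<forall>C\<in>set T. C \<subseteq> {1..n} \<Longrightarrow> j \<notin> last T \<Longrightarrow> Suc j \<in> last T \<Longrightarrow>
    Phi (T @ X) = hadd (act (sigma j (hd T)) j (Phi (map (scol j) T @ X)))
      (hsum (\<lambda>k. hscale (coef j T k) (Phi (Omega j k T @ X))) {1..<length T})"
proof (induction T rule: list_nonempty_induct)
  case (single C)
  then have C: "C \<in> cols n (card C)" and jC: "j \<notin> C" "Suc j \<in> C" by (auto intro!: cols_card)
  let ?S = "scol j C"
  have "B C h = bar j (B ?S h)" if "h \<in> hecke n" for h
    using B_scol[OF scol_cols[OF C j] j _ _ that] jC by simp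
  then have "Phi ([C] @ X) = bar j (Phi ([?S] @ X))"
    using comp_at_one_invariant[OF C j jC X(2)] X(1) by simp
  then have "Phi ([C] @ X) = hadd (act (sigma j (hd [C])) j (Phi (map (scol j) [C] @ X)))
      (hsum (\<lambda>k. hscale (coef j [C] k) (Phi (Omega j k [C] @ X))) {1..<length [C]})"
    using jC by (simp add: act_def sigma_def hsum_def hadd_def)
  then show ?case .
next
  case (cons C T)
  then have C: "C \<in> cols n (card C)" by (auto intro!: cols_card)
  let ?r = "length T" and ?s = "sigma j (hd T)" and ?s' = "sigma j C"
  let ?Q = "Phi (map (scol j) T @ X)"
  let ?f = "\<lambda>k. hscale (coef j T k) (Phi (Omega j k T @ X))"
  let ?g = "\<lambda>k. hscale (coef j (C # T) k) (Phi (Omega j k (C # T) @ X))"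
  have r: "1 \<le> ?r" using cons.hyps by (simp add: Suc_leI)
  have IH: "Phi (T @ X) = hadd (act ?s j ?Q) (hsum ?f {1..<?r})"
    using cons by simp
  \<comment> \<open>Counted from the right, column \<open>?r\<close> of the extended tableau is the
    old head and column \<open>Suc ?r\<close> is C.\<close>
  have "coef j (C # T) ?r = (if ?s * ?s' = -1 then of_int ?s * (1 - t) else 0)"
    using cons.hyps by (simp add: coef_def colk_def hd_conv_nth)
  moreover have "Omega j ?r (C # T) = C # map (scol j) T"
    by (simp add: Omega_Cons Omega_length)
  ultimately have g_last: "?g ?r = hscale (if ?s * ?s' = -1 then of_int ?s * (1 - t) else 0) (B C (comp_at C ?Q))"
    by simp
  have "B C (comp_at C (act ?s j ?Q)) = hadd (B C (comp_at C (act ?s' j ?Q))) (?g ?r)"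
    unfolding g_last act_switch[OF sigma_cases sigma_cases, of j "hd T" j "?Q" j C]
    by (simp add: comp_at_hadd comp_at_hscale B_hadd[OF C] B_hscale[OF C])
  also have "B C (comp_at C (act ?s' j ?Q)) = act ?s' j (Phi (map (scol j) (C # T) @ X))"
    using B_comp_at_act[OF C j, of ?Q] by simp
  finally have first: "B C (comp_at C (act ?s j ?Q)) = hadd (act ?s' j (Phi (map (scol j) (C # T) @ X))) (?g ?r)" .
  have "B C (comp_at C (hsum ?f {1..<?r})) = hsum (\<lambda>k. B C (comp_at C (?f k))) {1..<?r}"
    unfolding comp_at_hsum by (rule B_hsum[OF C]) simp
  also have "\<dots> = hsum ?g {1..<?r}"
    unfolding hsum_def
  proof (intro ext sum.cong refl)
    fix v k assume k: "k \<in> {1..<?r}"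
    then have "coef j (C # T) k = coef j T k" by (simp add: coef_def colk_Cons)
    then show "B C (comp_at C (?f k)) v = ?g k v"
      using k by (simp add: comp_at_hscale B_hscale[OF C] Omega_Cons)
  qed
  finally have second: "B C (comp_at C (hsum ?f {1..<?r})) = hsum ?g {1..<?r}" .
  have "Phi ((C # T) @ X) = hadd (B C (comp_at C (act ?s j ?Q))) (B C (comp_at C (hsum ?f {1..<?r})))"
    using IH by (simp add: comp_at_hadd B_hadd[OF C] hsum_hecke)
  also have "\<dots> = hadd (act ?s' j (Phi (map (scol j) (C # T) @ X))) (hsum ?g {1..<length (C # T)})"
    unfolding first second list.size(4) add_Suc_right add_0_right hsum_Suc[OF r] hadd_assoc
    by (rule arg_cong[OF hadd_commute])
  finally have "Phi ((C # T) @ X) = hadd (act (sigma j (hd (C # T))) j (Phi (map (scol j) (C # T) @ X)))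
      (hsum ?g {1..<length (C # T)})" by (simp only: list.sel)
  then show ?case .
qed

end

section \<open>The tableau attached to mu\<close>

lemma T0_props:
  shows "\<forall>C\<in>set (T0 n mu). C \<subseteq> {1..n} \<and> card C \<le> nparts n mu"
    and "sorted_wrt (\<lambda>C D. card D \<le> card C) (T0 n mu)"
    and "highest_weight (T0 n mu)"
    and "T0 n mu \<noteq> [] \<Longrightarrow> T0 n mu ! 0 = {1..nparts n mu}"
proof -
  let ?m = "\<lambda>c. card {i \<in> {1..n}. c \<le> mu i}"
  have mono: "?m d \<le> ?m c" if "c \<le> d" for c d using that by (intro card_mono) auto
  have m1: "?m 1 = nparts n mu" by (simp add: nparts_def Suc_le_eq)
  have mn: "?m c \<le> n" for c
    using card_mono[of "{1..n}" "{i \<in> {1..n}. c \<le> mu i}"] by fastforce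
  have "{1..?m c} \<subseteq> {1..n} \<and> card {1..?m c} \<le> nparts n mu" if "1 \<le> c" for c
    using mn[of c] mono[OF that] m1 by simp
  then show "\<forall>C\<in>set (T0 n mu). C \<subseteq> {1..n} \<and> card C \<le> nparts n mu"
    unfolding T0_def by (simp del: upt_Suc)
  show "sorted_wrt (\<lambda>C D. card D \<le> card C) (T0 n mu)"
    unfolding T0_def sorted_wrt_iff_nth_less by (auto simp del: upt_Suc intro!: card_mono)
  show "highest_weight (T0 n mu)"
    unfolding T0_def highest_weight_def by (simp del: upt_Suc)
  show "T0 n mu ! 0 = {1..nparts n mu}" if "T0 n mu \<noteq> []"
    using that m1 unfolding T0_def by (simp del: upt_Suc)
qed

text \<open>If j were at most the number of parts, semistandardness would give
  \<open>entry C j\<close> <= j, hence equality because columns increase strictly, and j would lie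
  in C. So j exceeds all column lengths and both values are 0.\<close>

lemma shape_T0_invariant:
  assumes C: "C \<subseteq> {1..n}" "nparts n mu \<le> card C" and j: "1 \<le> j" "j \<notin> C"
    and ss: "T0 n mu \<noteq> [] \<Longrightarrow> \<forall>k\<in>{1..card (T0 n mu ! 0)}. entry C k \<le> entry (T0 n mu ! 0) k"
  shows "shape (T0 n mu) j = shape (T0 n mu) (Suc j)"
proof (cases "T0 n mu = []")
  case True
  then show ?thesis by (simp add: shape_def)
next
  case False
  let ?m = "nparts n mu"
  have "?m < j"
  proof (rule ccontr)
    assume "\<not> ?m < j"
    then have jm: "j \<in> {1..?m}" using j by simp
    then have jC: "j \<in> {1..card C}" using C(2) by simp
    have "\<forall>k\<in>{1..?m}. entry C k \<le> entry {1..?m} k"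
      using ss[OF False] unfolding T0_props(4)[OF False] by simp
    then have "entry C j \<le> j" using jm entry_highest[OF jm] by fastforce
    then have "entry C j = j" using le_entry[OF C(1) jC] by simp
    moreover have "entry C j \<in> C"
      using bij_betw_apply[OF bij_betw_entry[OF finite_subset[OF C(1)]] jC] by simp
    ultimately show False using j by simp
  qed
  then have "shape (T0 n mu) i = 0" if "j \<le> i" for i
    using that T0_props(1)[of n mu] by (fastforce simp: shape_def filter_empty_conv)
  then show ?thesis by simp
qed

lemma hsum_hscale_filter:
  assumes "finite A"
  shows "hsum (\<lambda>k. hscale (c k) (f k)) {k \<in> A. P k}
    = hsum (\<lambda>k. hscale (if P k then c k else 0) (f k)) A"
  using assms by (auto simp: hsum_def hscale_def sum.inter_filter fun_eq_iff intro!: sum.cong)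

theorem theorem6p2:
  fixes t :: "'a::comm_ring_1" and n :: nat and T :: "nat set list"
  assumes "t dvd 1" and "1 \<le> n" and "is_tab n T"
  shows "(\<not> semistandard T \<longrightarrow> Psi t n T = hzero)
    \<and> (highest_weight T \<longrightarrow> Psi t n T = one_lam n (shape T))
    \<and> (\<forall>mu j. is_partition n mu \<and> nparts n mu \<le> card (last T)
          \<and> semistandard (T @ T0 n mu) \<and> j \<in> {1..n - 1} \<and> j \<notin> last T \<and> Suc j \<in> last T
        \<longrightarrow> Psi t n (T @ T0 n mu) =
            hadd (if j \<in> hd T \<and> Suc j \<notin> hd T
                  then hmult t n (hbasis (sgen j)) (Psi t n (Omega j (length T) T @ T0 n mu))
                  else hscale t (hmult t n (hinv t n (hbasis (sgen j)))
                          (Psi t n (Omega j (length T) T @ T0 n mu))))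
              (hsum (\<lambda>k. hscale (of_int (sigma j (colk T k)) * (1 - t))
                        (Psi t n (Omega j k T @ T0 n mu)))
                 {k \<in> {1..<length T}. sigma j (colk T k) * sigma j (colk T (Suc k)) = -1}))"
proof (intro conjI impI allI)
  interpret hecke_unit t n using assms(1) by unfold_locales
  have T: "T \<noteq> []" "\<forall>C\<in>set T. C \<subseteq> {1..n}" "sorted_wrt (\<lambda>C D. card D \<le> card C) T"
    using assms(3) by (simp_all add: is_tab_def)
  show "Psi t n T = hzero" if "\<not> semistandard T"
    using Psi_eq_Phi[OF T(1,2)] Phi_not_semistandard[OF T(2,3) that] by simp
  show "Psi t n T = one_lam n (shape T)" if "highest_weight T"
    using Psi_eq_Phi[OF T(1,2)] Phi_highest_weight[OF T(2,3) that] by simp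
  fix mu j
  assume A: "is_partition n mu \<and> nparts n mu \<le> card (last T)
          \<and> semistandard (T @ T0 n mu) \<and> j \<in> {1..n - 1} \<and> j \<notin> last T \<and> Suc j \<in> last T"
  let ?X = "T0 n mu"
  have j: "j \<in> {1..<n}" using A assms(2) by auto
  have X: "\<forall>C\<in>set ?X. C \<subseteq> {1..n}" using T0_props(1) by blast
  have Psi: "Psi t n (S @ ?X) = Phi (S @ ?X)" if "S \<noteq> []" "\<forall>C\<in>set S. C \<subseteq> {1..n}" for S
    using Psi_eq_Phi[of "S @ ?X"] that X by auto
  have Om: "Omega j k T \<noteq> []" "\<forall>C\<in>set (Omega j k T). C \<subseteq> {1..n}" for k
  proof -
    show "Omega j k T \<noteq> []" using T(1) by (simp add: Omega_def)
    show "\<forall>C\<in>set (Omega j k T). C \<subseteq> {1..n}"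
      unfolding Omega_def set_append set_map using T(2) scol_subset[OF _ j]
      by (blast dest: in_set_takeD in_set_dropD)
  qed
  have PhiX: "Phi ?X = one_lam n (shape ?X)"
    using Phi_highest_weight[OF X T0_props(2,3)] .
  have "shape ?X j = shape ?X (Suc j)"
  proof (rule shape_T0_invariant)
    show "last T \<subseteq> {1..n}" "nparts n mu \<le> card (last T)" "1 \<le> j" "j \<notin> last T"
      using T A last_in_set[OF T(1)] by auto
    assume ne: "?X \<noteq> []"
    \<comment> \<open>The rightmost column of T and the first column of the appended tableau are
      neighbours, and semistandardness is used for this pair only.\<close>
    have "(T @ ?X) ! (length T - 1) = last T" "(T @ ?X) ! Suc (length T - 1) = ?X ! 0"
      using T(1) by (simp_all add: nth_append last_conv_nth)
    moreover have "Suc (length T - 1) < length (T @ ?X)" using T(1) ne by simp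
    ultimately show "\<forall>k\<in>{1..card (?X ! 0)}. entry (last T) k \<le> entry (?X ! 0) k"
      using A unfolding semistandard_def by metis
  qed
  then have "Phi (T @ ?X) = hadd (act (sigma j (hd T)) j (Phi (map (scol j) T @ ?X)))
      (hsum (\<lambda>k. hscale (coef j T k) (Phi (Omega j k T @ ?X))) {1..<length T})"
    using Phi_recursion[OF j PhiX _ T(1,2)] A by blast
  \<comment> \<open>Sign -1 is the case of T_j; otherwise \<open>bar j\<close> is rewritten as t
    times multiplication by the inverse of T_j.\<close>
  moreover have "act (sigma j (hd T)) j (Phi (map (scol j) T @ ?X)) =
      (if j \<in> hd T \<and> Suc j \<notin> hd T
       then hmult t n (hbasis (sgen j)) (Psi t n (Omega j (length T) T @ ?X))
       else hscale t (hmult t n (hinv t n (hbasis (sgen j))) (Psi t n (Omega j (length T) T @ ?X))))"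
    unfolding Psi[OF Om] unfolding Omega_length
    using hmult_hbasis[OF sgen_perms[OF j]] hscale_hinv_sgen[OF j] LW_sgen[OF j]
    by (simp add: act_def sigma_def)
  moreover have "hsum (\<lambda>k. hscale (coef j T k) (Phi (Omega j k T @ ?X))) {1..<length T} =
      hsum (\<lambda>k. hscale (of_int (sigma j (colk T k)) * (1 - t)) (Psi t n (Omega j k T @ ?X)))
        {k \<in> {1..<length T}. sigma j (colk T k) * sigma j (colk T (Suc k)) = -1}"
    unfolding Psi[OF Om] coef_def by (rule hsum_hscale_filter[symmetric]) simp
  ultimately show "Psi t n (T @ ?X) =
            hadd (if j \<in> hd T \<and> Suc j \<notin> hd T
                  then hmult t n (hbasis (sgen j)) (Psi t n (Omega j (length T) T @ T0 n mu))
                  else hscale t (hmult t n (hinv t n (hbasis (sgen j)))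
                          (Psi t n (Omega j (length T) T @ T0 n mu))))
              (hsum (\<lambda>k. hscale (of_int (sigma j (colk T k)) * (1 - t))
                        (Psi t n (Omega j k T @ T0 n mu)))
                 {k \<in> {1..<length T}. sigma j (colk T k) * sigma j (colk T (Suc k)) = -1})"
    unfolding Psi[OF T(1,2)] by (simp only:)
qed

end
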